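(* Let $R$ be a ring and let $S$ and $T$ be classes of finitely presented left $R$-modules. Consider the following statements: (1) Every $S$-pure short exact sequence of left $R$-modules is $T$-pure. (2) Each indecomposable direct summand of a module in $T$ is in $\mathrm{add}(S\cup\{{}_RR\})$. (3) Each indecomposable direct summand of a module in $T$ is a direct summand of a module in $S\cup\{{}_RR\}$. Then (1) implies (2), and: (a) If each indecomposable direct summand of a module in $T$ has local endomorphism ring, then (2) implies (3). (b) If each module in $T$ is a direct sum of indecomposable modules, then (3) implies (1).
   Context: Rings are associative with unity and modules are unital; classes of modules are closed under isomorphism. For a class $X$ of left $R$-modules, a short exact sequence $0\to A\to B\to C\to 0$ of left $R$-modules is $X$-pure if $0\to \mathrm{Hom}_R(M,A)\to \mathrm{Hom}_R(M,B)\to \mathrm{Hom}_R(M,C)\to 0$ is exact for all $M\in X$. $\mathrm{add}(X)$ denotes the class of all direct summands of finite direct sums of modules from $X$. *)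

theory Defs
  imports "HOL-Algebra.Algebra" "HOL-Library.Equipollence"
begin

section \<open>Left modules over a not necessarily commutative ring\<close>

text \<open>
  The locale \<^locale>\<open>module\<close> of the library demands a commutative ring of scalars. The following
  locale has the same axioms over an arbitrary ring with unity; it uses the same record type, whose
  fields \<^const>\<open>monoid.mult\<close> and \<^const>\<open>one\<close> are irrelevant for modules.
\<close>

locale left_module = R?: ring R + M?: abelian_group M
  for R :: "('a, 'r) ring_scheme" (structure) and M :: "('a, 'u, 'm) module_scheme" (structure) +
  assumes smult_closed [simp, intro]:
      "\<lbrakk>a \<in> carrier R; x \<in> carrier M\<rbrakk> \<Longrightarrow> a \<odot>\<^bsub>M\<^esub> x \<in> carrier M"
    and smult_l_distr:
      "\<lbrakk>a \<in> carrier R; b \<in> carrier R; x \<in> carrier M\<rbrakk> \<Longrightarrow>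
        (a \<oplus>\<^bsub>R\<^esub> b) \<odot>\<^bsub>M\<^esub> x = a \<odot>\<^bsub>M\<^esub> x \<oplus>\<^bsub>M\<^esub> b \<odot>\<^bsub>M\<^esub> x"
    and smult_r_distr:
      "\<lbrakk>a \<in> carrier R; x \<in> carrier M; y \<in> carrier M\<rbrakk> \<Longrightarrow>
        a \<odot>\<^bsub>M\<^esub> (x \<oplus>\<^bsub>M\<^esub> y) = a \<odot>\<^bsub>M\<^esub> x \<oplus>\<^bsub>M\<^esub> a \<odot>\<^bsub>M\<^esub> y"
    and smult_assoc1:
      "\<lbrakk>a \<in> carrier R; b \<in> carrier R; x \<in> carrier M\<rbrakk> \<Longrightarrow>
        (a \<otimes>\<^bsub>R\<^esub> b) \<odot>\<^bsub>M\<^esub> x = a \<odot>\<^bsub>M\<^esub> (b \<odot>\<^bsub>M\<^esub> x)"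
    and smult_one [simp]:
      "x \<in> carrier M \<Longrightarrow> \<one>\<^bsub>R\<^esub> \<odot>\<^bsub>M\<^esub> x = x"

lemma left_module_iff_module:
  assumes "cring R"
  shows "left_module R M \<longleftrightarrow> module R M"
  using assms unfolding left_module_def left_module_axioms_def module_def module_axioms_def
  by (auto simp: cring_def)

definition regular_module :: "('a, 'r) ring_scheme \<Rightarrow> ('a, 'a) module" where
  "regular_module R =
     \<lparr>carrier = carrier R, monoid.mult = monoid.mult R, one = one R, ring.zero = ring.zero R, ring.add = ring.add R,
      smult = monoid.mult R\<rparr>"

lemma left_module_regular_module:
  assumes "ring R"
  shows "left_module R (regular_module R)"
proof -
  interpret ring R by (rule assms)
  show ?thesis
    unfolding left_module_def left_module_axioms_def regular_module_def
    by (auto simp: assms l_distr r_distr m_assoc intro!: abelian_groupI a_assoc a_comm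
        bexI[of _ "\<ominus>\<^bsub>R\<^esub> _"] l_neg)
qed


section \<open>Homomorphisms\<close>

definition mod_hom ::
  "('a, 'r) ring_scheme \<Rightarrow> ('a, 'u, 'm) module_scheme \<Rightarrow> ('a, 'v, 'n) module_scheme \<Rightarrow> ('u \<Rightarrow> 'v) set"
where
  "mod_hom R M N =
     {h \<in> hom (add_monoid M) (add_monoid N).
        \<forall>a \<in> carrier R. \<forall>x \<in> carrier M. h (a \<odot>\<^bsub>M\<^esub> x) = a \<odot>\<^bsub>N\<^esub> h x}"

definition mod_isomorphic ::
  "('a, 'r) ring_scheme \<Rightarrow> ('a, 'u, 'm) module_scheme \<Rightarrow> ('a, 'v, 'n) module_scheme \<Rightarrow> bool"
where
  "mod_isomorphic R M N \<longleftrightarrow>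
     left_module R M \<and> left_module R N \<and>
     (\<exists>h \<in> mod_hom R M N. bij_betw h (carrier M) (carrier N))"

text \<open>
  The abelian group $\mathrm{Hom}_R(M,N)$. Its elements are restricted to functions that are
  undefined off the carrier of \<open>M\<close>, so that equal homomorphisms are equal as HOL functions.
\<close>

definition Hom_group ::
  "('a, 'r) ring_scheme \<Rightarrow> ('a, 'u, 'm) module_scheme \<Rightarrow> ('a, 'v, 'n) module_scheme \<Rightarrow> ('u \<Rightarrow> 'v) monoid"
where
  "Hom_group R M N =
     \<lparr>carrier = mod_hom R M N \<inter> extensional (carrier M),
      monoid.mult = (\<lambda>h k. \<lambda>x \<in> carrier M. h x \<oplus>\<^bsub>N\<^esub> k x),
      one = (\<lambda>x \<in> carrier M. \<zero>\<^bsub>N\<^esub>)\<rparr>"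

definition End_ring :: "('a, 'r) ring_scheme \<Rightarrow> ('a, 'u, 'm) module_scheme \<Rightarrow> ('u \<Rightarrow> 'u) ring" where
  "End_ring R M =
     \<lparr>carrier = carrier (Hom_group R M M),
      monoid.mult = compose (carrier M),
      one = (\<lambda>x \<in> carrier M. x),
      ring.zero = one (Hom_group R M M),
      ring.add = monoid.mult (Hom_group R M M)\<rparr>"

text \<open>A not necessarily commutative ring is local if it is nonzero and a sum of two non-units is a
  non-unit.\<close>

definition local_ring :: "('a, 'r) ring_scheme \<Rightarrow> bool" where
  "local_ring E \<longleftrightarrow>
     ring E \<and> \<one>\<^bsub>E\<^esub> \<noteq> \<zero>\<^bsub>E\<^esub> \<and>
     (\<forall>x \<in> carrier E - Units E. \<forall>y \<in> carrier E - Units E. x \<oplus>\<^bsub>E\<^esub> y \<in> carrier E - Units E)"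


section \<open>Direct sums and direct summands\<close>

definition direct_sum ::
  "'i set \<Rightarrow> ('i \<Rightarrow> ('a, 'u, 'm) module_scheme) \<Rightarrow> ('a, 'i \<Rightarrow> 'u) module"
where
  "direct_sum I F =
     (let G = sum_group I (\<lambda>i. add_monoid (F i)) in
      \<lparr>carrier = carrier G, monoid.mult = undefined, one = undefined, ring.zero = one G,
       ring.add = monoid.mult G,
       smult = (\<lambda>a x. \<lambda>i \<in> I. a \<odot>\<^bsub>F i\<^esub> x i)\<rparr>)"

definition internal_direct_sum ::
  "('a, 'r) ring_scheme \<Rightarrow> ('a, 'u, 'm) module_scheme \<Rightarrow> 'u set \<Rightarrow> 'u set \<Rightarrow> bool"
where
  "internal_direct_sum R M A B \<longleftrightarrow>
     submodule A R M \<and> submodule B R M \<and> A <+>\<^bsub>M\<^esub> B = carrier M \<and> A \<inter> B = {\<zero>\<^bsub>M\<^esub>}"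

text \<open>As usual, being a direct summand is understood up to isomorphism.\<close>

definition direct_summand ::
  "('a, 'r) ring_scheme \<Rightarrow> ('a, 'u, 'm) module_scheme \<Rightarrow> ('a, 'v, 'n) module_scheme \<Rightarrow> bool"
where
  "direct_summand R M N \<longleftrightarrow>
     left_module R N \<and>
     (\<exists>A B. internal_direct_sum R N A B \<and> mod_isomorphic R M (N\<lparr>carrier := A\<rparr>))"

definition indecomposable :: "('a, 'r) ring_scheme \<Rightarrow> ('a, 'u, 'm) module_scheme \<Rightarrow> bool" where
  "indecomposable R M \<longleftrightarrow>
     left_module R M \<and> carrier M \<noteq> {\<zero>\<^bsub>M\<^esub>} \<and>
     (\<forall>A B. internal_direct_sum R M A B \<longrightarrow> A = {\<zero>\<^bsub>M\<^esub>} \<or> B = {\<zero>\<^bsub>M\<^esub>})"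

text \<open>
  The index set is a possibly infinite subset of the type of elements of \<open>M\<close>. This is no restriction:
  choosing a nonzero element in each (nonzero) summand embeds any index set into \<open>M\<close>.
\<close>

definition direct_sum_of_indecomposables ::
  "('a, 'r) ring_scheme \<Rightarrow> ('a, 'u) module \<Rightarrow> bool"
where
  "direct_sum_of_indecomposables R M \<longleftrightarrow>
     (\<exists>(I :: 'u set) (F :: 'u \<Rightarrow> ('a, 'u) module).
        (\<forall>i \<in> I. indecomposable R (F i)) \<and> mod_isomorphic R M (direct_sum I F))"


section \<open>Classes of modules\<close>

text \<open>
  A class of left \<open>R\<close>-modules is a set of modules with elements in a fixed type \<open>'u\<close>, which
  plays the role of a universe. The type variable \<open>'u\<close> is arbitrary; to contain copies of the
  regular module and of all finitely presented modules it has to be infinite and at least as large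
  as \<open>R\<close>.
\<close>

definition iso_closed :: "('a, 'r) ring_scheme \<Rightarrow> ('a, 'u) module set \<Rightarrow> bool" where
  "iso_closed R Xs \<longleftrightarrow> (\<forall>M \<in> Xs. \<forall>N. mod_isomorphic R M N \<longrightarrow> N \<in> Xs)"

text \<open>The class $\{{}_RR\}$, closed under isomorphism.\<close>

definition regular_class :: "('a, 'r) ring_scheme \<Rightarrow> ('a, 'u) module set" where
  "regular_class R = {M. mod_isomorphic R M (regular_module R)}"

definition add_class :: "('a, 'r) ring_scheme \<Rightarrow> ('a, 'u) module set \<Rightarrow> ('a, 'u) module set" where
  "add_class R Xs =
     {M. \<exists>(n :: nat) F. (\<forall>i < n. F i \<in> Xs) \<and> direct_summand R M (direct_sum {..<n} F)}"

text \<open>An exact sequence $R^m \to R^n \to M \to 0$.\<close>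

definition finitely_presented :: "('a, 'r) ring_scheme \<Rightarrow> ('a, 'u, 'm) module_scheme \<Rightarrow> bool" where
  "finitely_presented R M \<longleftrightarrow>
     left_module R M \<and>
     (\<exists>(m :: nat) (n :: nat) f g.
        let Rm = direct_sum {..<m} (\<lambda>_. regular_module R);
            Rn = direct_sum {..<n} (\<lambda>_. regular_module R)
        in f \<in> mod_hom R Rm Rn \<and> g \<in> mod_hom R Rn M \<and>
           f ` carrier Rm = a_kernel Rn M g \<and> g ` carrier Rn = carrier M)"


section \<open>Purity\<close>

text \<open>
  Short exactness of $0\to A\to B\to C\to 0$ as a sequence of groups. (The library's
  \<^const>\<open>short_exact_sequence\<close> lists the groups in the opposite order and demands the plain
  record type of monoids.)
\<close>

definition short_exact ::
  "('a, 'm) monoid_scheme \<Rightarrow> ('b, 'n) monoid_scheme \<Rightarrow> ('c, 'k) monoid_scheme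
     \<Rightarrow> ('a \<Rightarrow> 'b) \<Rightarrow> ('b \<Rightarrow> 'c) \<Rightarrow> bool"
where
  "short_exact A B C f g \<longleftrightarrow>
     group A \<and> group B \<and> group C \<and> f \<in> mon A B \<and> g \<in> epi B C \<and> f ` carrier A = kernel B C g"

definition mod_short_exact ::
  "('a, 'r) ring_scheme \<Rightarrow> ('a, 'u, 'm) module_scheme \<Rightarrow> ('a, 'v, 'n) module_scheme
     \<Rightarrow> ('a, 'w, 'k) module_scheme \<Rightarrow> ('u \<Rightarrow> 'v) \<Rightarrow> ('v \<Rightarrow> 'w) \<Rightarrow> bool"
where
  "mod_short_exact R A B C f g \<longleftrightarrow>
     left_module R A \<and> left_module R B \<and> left_module R C \<and>
     f \<in> mod_hom R A B \<and> g \<in> mod_hom R B C \<and>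
     short_exact (add_monoid A) (add_monoid B) (add_monoid C) f g"

text \<open>Purity, with respect to \<open>Xs\<close>, of a given short exact sequence; \<open>compose (carrier M) f\<close> is $\mathrm{Hom}_R(M,f)$.\<close>

definition pure ::
  "('a, 'r) ring_scheme \<Rightarrow> ('a, 'u) module set \<Rightarrow> ('a, 'v, 'm) module_scheme
     \<Rightarrow> ('a, 'w, 'n) module_scheme \<Rightarrow> ('a, 'x, 'k) module_scheme
     \<Rightarrow> ('v \<Rightarrow> 'w) \<Rightarrow> ('w \<Rightarrow> 'x) \<Rightarrow> bool"
where
  "pure R Xs A B C f g \<longleftrightarrow>
     (\<forall>M \<in> Xs. short_exact (Hom_group R M A) (Hom_group R M B) (Hom_group R M C)
                (compose (carrier M) f) (compose (carrier M) g))"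


section \<open>Comparing purities\<close>

definition indecomposable_summands ::
  "('a, 'r) ring_scheme \<Rightarrow> ('a, 'u) module set \<Rightarrow> ('a, 'u) module set"
where
  "indecomposable_summands R T = {M. indecomposable R M \<and> (\<exists>N \<in> T. direct_summand R M N)}"

definition pure_imp_pure ::
  "('a, 'r) ring_scheme \<Rightarrow> ('a, 'u) module set \<Rightarrow> ('a, 'u) module set \<Rightarrow> bool"
where
  "pure_imp_pure R S T \<longleftrightarrow>
     (\<forall>(A :: ('a, 'u) module) (B :: ('a, 'u) module) (C :: ('a, 'u) module) f g.
        mod_short_exact R A B C f g \<and> pure R S A B C f g \<longrightarrow> pure R T A B C f g)"

definition summands_in_add ::
  "('a, 'r) ring_scheme \<Rightarrow> ('a, 'u) module set \<Rightarrow> ('a, 'u) module set \<Rightarrow> bool"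
where
  "summands_in_add R S T \<longleftrightarrow>
     (\<forall>M \<in> indecomposable_summands R T. M \<in> add_class R (S \<union> regular_class R))"

definition summands_are_summands ::
  "('a, 'r) ring_scheme \<Rightarrow> ('a, 'u) module set \<Rightarrow> ('a, 'u) module set \<Rightarrow> bool"
where
  "summands_are_summands R S T \<longleftrightarrow>
     (\<forall>M \<in> indecomposable_summands R T. \<exists>N \<in> S \<union> regular_class R. direct_summand R M N)"

end

theory Submission
  imports Defs
begin

text \<open>
  Purity with respect to a class means that all homomorphisms from its members to \<open>C\<close> lift along
  \<open>B \<rightarrow> C\<close>; this property passes to direct summands and direct sums and always holds for \<open>R\<close>, which
  gives (b). For (a), write the identity of an indecomposable summand \<open>M\<close> of \<open>F\<^sub>1 \<oplus> \<dots> \<oplus> F\<^sub>n\<close> as the sum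
  of the maps \<open>M \<rightarrow> F\<^sub>i \<rightarrow> M\<close>; by locality one of them is invertible.

  For the first implication, let \<open>M\<close> be a summand of \<open>N \<in> T\<close>, and map onto \<open>M\<close> a direct sum \<open>P\<close> of modules in
  \<open>S \<union> {R}\<close> through which every homomorphism from a module in \<open>S \<union> {R}\<close> to \<open>M\<close> factors. The kernel
  sequence is \<open>S\<close>-pure, hence \<open>T\<close>-pure, so the projection \<open>N \<rightarrow> M\<close> lifts to \<open>P\<close> and \<open>M\<close> is a summand
  of \<open>P\<close>; since \<open>M\<close> is finitely generated, finitely many summands of \<open>P\<close> suffice. As purity is
  only tested on modules with elements in \<open>'u\<close>, the summands of \<open>P\<close> have to be indexed by few
  representatives: a homomorphism \<open>k : Q \<rightarrow> M\<close> from a module \<open>R\<^sup>m \<rightarrow> R\<^sup>n \<rightarrow> Q \<rightarrow> 0\<close> is determined up to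
  isomorphism of \<open>Q\<close> by the relation submodule of \<open>R\<^sup>n\<close> and the composite \<open>R\<^sup>n \<rightarrow> M\<close>.
\<close>

section \<open>Homomorphisms and direct summands\<close>

context left_module
begin

lemma smult_r_null [simp]: "a \<in> carrier R \<Longrightarrow> a \<odot>\<^bsub>M\<^esub> \<zero>\<^bsub>M\<^esub> = \<zero>\<^bsub>M\<^esub>"
  using smult_r_distr[of a "\<zero>\<^bsub>M\<^esub>" "\<zero>\<^bsub>M\<^esub>"] M.add.l_cancel_one'[of "a \<odot>\<^bsub>M\<^esub> \<zero>\<^bsub>M\<^esub>" "a \<odot>\<^bsub>M\<^esub> \<zero>\<^bsub>M\<^esub>"]
  by simp

lemma smult_l_null [simp]: "x \<in> carrier M \<Longrightarrow> \<zero>\<^bsub>R\<^esub> \<odot>\<^bsub>M\<^esub> x = \<zero>\<^bsub>M\<^esub>"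
  using smult_l_distr[of "\<zero>\<^bsub>R\<^esub>" "\<zero>\<^bsub>R\<^esub>" x] M.add.l_cancel_one'[of "\<zero>\<^bsub>R\<^esub> \<odot>\<^bsub>M\<^esub> x" "\<zero>\<^bsub>R\<^esub> \<odot>\<^bsub>M\<^esub> x"]
  by simp

lemma smult_a_inv: "a \<in> carrier R \<Longrightarrow> x \<in> carrier M \<Longrightarrow> a \<odot>\<^bsub>M\<^esub> (\<ominus>\<^bsub>M\<^esub> x) = \<ominus>\<^bsub>M\<^esub> (a \<odot>\<^bsub>M\<^esub> x)"
  by (rule M.minus_equality[symmetric]) (simp_all add: M.l_neg flip: smult_r_distr)

end

lemma left_module_submodule:
  assumes "left_module R M" "submodule H R M"
  shows "left_module R (M\<lparr>carrier := H\<rparr>)"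
proof -
  interpret M: left_module R M by fact
  interpret H: submodule H R M by fact
  have "group ((add_monoid M)\<lparr>carrier := H\<rparr>)"
    by (rule subgroup.subgroup_is_group[OF H.subgroup_axioms M.add.group_axioms])
  then have "comm_group (add_monoid (M\<lparr>carrier := H\<rparr>))"
    using H.subset by (intro group.group_comm_groupI) (auto intro!: M.M.a_comm)
  then show ?thesis
    using H.subset[THEN subsetD]
    unfolding left_module_def left_module_axioms_def abelian_group_def abelian_group_axioms_def
    by (auto simp: M.smult_l_distr M.smult_r_distr M.smult_assoc1 M.R.ring_axioms comm_group_def
        intro!: abelian_monoid.intro)
qed

text \<open>Closure under negation follows from closure under scalars, as \<open>-x\<close> is the
  multiple of \<open>x\<close> by \<open>-1\<close>.\<close>

lemma submodule_of_closedI: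
  assumes "left_module R M" "H \<subseteq> carrier M" "\<zero>\<^bsub>M\<^esub> \<in> H"
    and "\<And>x y. x \<in> H \<Longrightarrow> y \<in> H \<Longrightarrow> x \<oplus>\<^bsub>M\<^esub> y \<in> H"
    and "\<And>a x. a \<in> carrier R \<Longrightarrow> x \<in> H \<Longrightarrow> a \<odot>\<^bsub>M\<^esub> x \<in> H"
  shows "submodule H R M"
proof -
  interpret M: left_module R M by fact
  have "\<ominus>\<^bsub>M\<^esub> x \<in> H" if "x \<in> H" for x
  proof -
    have x: "x \<in> carrier M" using that assms(2) by auto
    have "(\<ominus>\<^bsub>R\<^esub> \<one>\<^bsub>R\<^esub>) \<odot>\<^bsub>M\<^esub> x \<oplus>\<^bsub>M\<^esub> x = (\<ominus>\<^bsub>R\<^esub> \<one>\<^bsub>R\<^esub> \<oplus>\<^bsub>R\<^esub> \<one>\<^bsub>R\<^esub>) \<odot>\<^bsub>M\<^esub> x"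
      using x by (simp add: M.smult_l_distr)
    also have "\<dots> = \<zero>\<^bsub>M\<^esub>" using x by (simp add: M.R.l_neg)
    finally have "\<ominus>\<^bsub>M\<^esub> x = (\<ominus>\<^bsub>R\<^esub> \<one>\<^bsub>R\<^esub>) \<odot>\<^bsub>M\<^esub> x"
      using x by (intro M.M.minus_equality) auto
    then show ?thesis using assms(5) that by simp
  qed
  then show ?thesis
    using assms(2-5) unfolding submodule_def submodule_axioms_def
    by (auto intro!: subgroup.intro simp: a_inv_def)
qed

lemma submoduleD:
  assumes "submodule H R M"
  shows "H \<subseteq> carrier M" "\<zero>\<^bsub>M\<^esub> \<in> H" 
    "\<And>x y. x \<in> H \<Longrightarrow> y \<in> H \<Longrightarrow> x \<oplus>\<^bsub>M\<^esub> y \<in> H"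
    "\<And>x. x \<in> H \<Longrightarrow> \<ominus>\<^bsub>M\<^esub> x \<in> H"
    "\<And>a x. a \<in> carrier R \<Longrightarrow> x \<in> H \<Longrightarrow> a \<odot>\<^bsub>M\<^esub> x \<in> H"
proof -
  interpret H: submodule H R M by fact
  show "H \<subseteq> carrier M" "\<zero>\<^bsub>M\<^esub> \<in> H" "\<And>x y. x \<in> H \<Longrightarrow> y \<in> H \<Longrightarrow> x \<oplus>\<^bsub>M\<^esub> y \<in> H"
    "\<And>x. x \<in> H \<Longrightarrow> \<ominus>\<^bsub>M\<^esub> x \<in> H"
    "\<And>a x. a \<in> carrier R \<Longrightarrow> x \<in> H \<Longrightarrow> a \<odot>\<^bsub>M\<^esub> x \<in> H"
    using H.subset H.one_closed H.m_closed H.m_inv_closed by (auto simp: a_inv_def)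
qed

lemma mod_homI:
  assumes "\<And>x. x \<in> carrier M \<Longrightarrow> h x \<in> carrier N"
    and "\<And>x y. x \<in> carrier M \<Longrightarrow> y \<in> carrier M \<Longrightarrow> h (x \<oplus>\<^bsub>M\<^esub> y) = h x \<oplus>\<^bsub>N\<^esub> h y"
    and "\<And>a x. a \<in> carrier R \<Longrightarrow> x \<in> carrier M \<Longrightarrow> h (a \<odot>\<^bsub>M\<^esub> x) = a \<odot>\<^bsub>N\<^esub> h x"
  shows "h \<in> mod_hom R M N"
  using assms by (auto simp: mod_hom_def hom_def)

lemma
  assumes "h \<in> mod_hom R M N"
  shows mod_hom_closed: "x \<in> carrier M \<Longrightarrow> h x \<in> carrier N"
    and mod_hom_add: "x \<in> carrier M \<Longrightarrow> y \<in> carrier M \<Longrightarrow> h (x \<oplus>\<^bsub>M\<^esub> y) = h x \<oplus>\<^bsub>N\<^esub> h y"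
    and mod_hom_smult: "a \<in> carrier R \<Longrightarrow> x \<in> carrier M \<Longrightarrow> h (a \<odot>\<^bsub>M\<^esub> x) = a \<odot>\<^bsub>N\<^esub> h x"
  using assms by (auto simp: mod_hom_def hom_def)

text \<open>Being a homomorphism only concerns values on the carrier, which sums and scalar
  multiples do not leave. This allows passing between arbitrary functions and their restrictions,
  the elements of \<open>Hom_group\<close>.\<close>

lemma mod_hom_cong:
  assumes "left_module R M" "\<And>x. x \<in> carrier M \<Longrightarrow> h x = k x"
  shows "h \<in> mod_hom R M N \<longleftrightarrow> k \<in> mod_hom R M N"
proof -
  interpret M: left_module R M by fact
  show ?thesis using assms(2) by (auto simp: mod_hom_def hom_def Pi_def)
qed

lemma mod_hom_zero:
  assumes "left_module R M" "left_module R N" "h \<in> mod_hom R M N"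
  shows "h \<zero>\<^bsub>M\<^esub> = \<zero>\<^bsub>N\<^esub>"
proof -
  interpret M: left_module R M by fact
  interpret N: left_module R N by fact
  show ?thesis
    using mod_hom_add[OF assms(3), of "\<zero>\<^bsub>M\<^esub>" "\<zero>\<^bsub>M\<^esub>"] mod_hom_closed[OF assms(3), of "\<zero>\<^bsub>M\<^esub>"]
      N.M.add.l_cancel_one'[of "h \<zero>\<^bsub>M\<^esub>" "h \<zero>\<^bsub>M\<^esub>"] by simp
qed

lemma mod_hom_a_inv:
  assumes "left_module R M" "left_module R N" "h \<in> mod_hom R M N" "x \<in> carrier M"
  shows "h (\<ominus>\<^bsub>M\<^esub> x) = \<ominus>\<^bsub>N\<^esub> h x"
proof -
  interpret M: left_module R M by fact
  interpret N: left_module R N by fact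
  show ?thesis
    using assms mod_hom_add[OF assms(3), of "\<ominus>\<^bsub>M\<^esub> x" x] mod_hom_zero[OF assms(1-3)]
    by (intro N.M.minus_equality[symmetric]) (auto simp: M.M.l_neg mod_hom_closed)
qed

lemma mod_hom_compose:
  assumes "h \<in> mod_hom R M N" "k \<in> mod_hom R N L"
  shows "k \<circ> h \<in> mod_hom R M L"
  using assms by (intro mod_homI) (auto simp: mod_hom_closed mod_hom_add mod_hom_smult)

lemma mod_hom_inv_into:
  assumes "left_module R M" "h \<in> mod_hom R M N" "bij_betw h (carrier M) (carrier N)"
  shows "inv_into (carrier M) h \<in> mod_hom R N M"
proof -
  interpret M: left_module R M by fact
  have inj: "inj_on h (carrier M)" and im: "h ` carrier M = carrier N"
    using assms(3) by (auto simp: bij_betw_def)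
  have *: "inv_into (carrier M) h y = x" if "x \<in> carrier M" "y = h x" for x y
    using that inj by simp
  show ?thesis
  proof (rule mod_homI)
    show "inv_into (carrier M) h x \<in> carrier M" if "x \<in> carrier N" for x
      using that im inv_into_into by metis
  next
    fix x y assume "x \<in> carrier N" "y \<in> carrier N"
    then obtain u v where "u \<in> carrier M" "v \<in> carrier M" "x = h u" "y = h v"
      using im by blast
    then show "inv_into (carrier M) h (x \<oplus>\<^bsub>N\<^esub> y) =
        inv_into (carrier M) h x \<oplus>\<^bsub>M\<^esub> inv_into (carrier M) h y"
      using inj by (simp flip: mod_hom_add[OF assms(2)])
  next
    fix a x assume "a \<in> carrier R" "x \<in> carrier N"
    moreover then obtain u where "u \<in> carrier M" "x = h u"
      using im by auto
    ultimately show "inv_into (carrier M) h (a \<odot>\<^bsub>N\<^esub> x) = a \<odot>\<^bsub>M\<^esub> inv_into (carrier M) h x"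
      using inj by (simp flip: mod_hom_smult[OF assms(2)])
  qed
qed

lemma submodule_kernel:
  assumes "left_module R M" "left_module R N" "h \<in> mod_hom R M N"
  shows "submodule {x \<in> carrier M. h x = \<zero>\<^bsub>N\<^esub>} R M"
proof -
  interpret M: left_module R M by fact
  interpret N: left_module R N by fact
  show ?thesis
    using assms by (intro submodule_of_closedI) (auto simp: mod_hom_zero mod_hom_add mod_hom_smult)
qed

lemma submodule_image:
  assumes "left_module R M" "left_module R N" "h \<in> mod_hom R M N"
  shows "submodule (h ` carrier M) R N"
proof -
  interpret M: left_module R M by fact
  show ?thesis
    using assms
    by (intro submodule_of_closedI)
      (auto simp: mod_hom_closed image_iff intro: mod_hom_zero[symmetric]
        simp flip: mod_hom_add mod_hom_smult)
qed

text \<open>A section \<open>s\<close> with retraction \<open>p\<close> splits \<open>N\<close> into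
  the image of \<open>s\<close> and the kernel of \<open>p\<close>, since
  \<open>x = s (p x) + (x - s (p x))\<close>. Together with the converse below, this lets summands
  be handled as retracts.\<close>

lemma direct_summandI:
  assumes "left_module R M" "left_module R N" "s \<in> mod_hom R M N" "p \<in> mod_hom R N M"
    and ps: "\<And>x. x \<in> carrier M \<Longrightarrow> p (s x) = x"
  shows "direct_summand R M N"
proof -
  interpret M: left_module R M by fact
  interpret N: left_module R N by fact
  let ?A = "s ` carrier M" and ?B = "{x \<in> carrier N. p x = \<zero>\<^bsub>M\<^esub>}"
  note cl = mod_hom_closed[OF assms(3)] mod_hom_closed[OF assms(4)]
  have sub: "submodule ?A R N" "submodule ?B R N"
    using assms by (auto intro: submodule_image submodule_kernel)
  have "x \<in> ?A <+>\<^bsub>N\<^esub> ?B" if x: "x \<in> carrier N" for x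
  proof -
    have "x = s (p x) \<oplus>\<^bsub>N\<^esub> (\<ominus>\<^bsub>N\<^esub> s (p x) \<oplus>\<^bsub>N\<^esub> x)"
      using x cl by (simp add: N.M.r_neg flip: N.M.a_assoc)
    moreover have "p (\<ominus>\<^bsub>N\<^esub> s (p x) \<oplus>\<^bsub>N\<^esub> x) = \<zero>\<^bsub>M\<^esub>"
      using x cl assms by (simp add: mod_hom_add mod_hom_a_inv M.M.l_neg)
    ultimately show ?thesis
      using x cl unfolding set_add_def set_mult_def
      by (auto intro!: bexI[of _ "p x"] exI[of _ "\<ominus>\<^bsub>N\<^esub> s (p x) \<oplus>\<^bsub>N\<^esub> x"])
  qed
  then have "?A <+>\<^bsub>N\<^esub> ?B = carrier N"
    using cl by (auto simp: set_add_def set_mult_def)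
  moreover have "?A \<inter> ?B = {\<zero>\<^bsub>N\<^esub>}"
    using ps mod_hom_zero[OF assms(1-3)] mod_hom_zero[OF assms(2,1,4)] by force
  moreover have "s \<in> mod_hom R M (N\<lparr>carrier := ?A\<rparr>)"
    using assms(3) by (auto simp: mod_hom_def hom_def)
  moreover have "bij_betw s (carrier M) ?A"
    using ps by (metis inj_on_imp_bij_betw inj_on_inverseI)
  ultimately show ?thesis
    using assms(1,2) sub left_module_submodule[OF assms(2) sub(1)]
    unfolding direct_summand_def internal_direct_sum_def mod_isomorphic_def
    by auto
qed

text \<open>The retraction is the projection onto \<open>A\<close> along \<open>B\<close>, followed
  by the inverse of the isomorphism from \<open>M\<close> to \<open>A\<close>; the section is that
  isomorphism, viewed as a map into \<open>N\<close>.\<close>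

lemma direct_summandE:
  assumes "direct_summand R M N"
  obtains s p where "left_module R M" "left_module R N" "s \<in> mod_hom R M N" "p \<in> mod_hom R N M"
    "\<And>x. x \<in> carrier M \<Longrightarrow> p (s x) = x"
proof -
  obtain A B h where N: "left_module R N" and M: "left_module R M"
    and sub: "submodule A R N" "submodule B R N" and sum: "A <+>\<^bsub>N\<^esub> B = carrier N"
    and int: "A \<inter> B = {\<zero>\<^bsub>N\<^esub>}"
    and h: "h \<in> mod_hom R M (N\<lparr>carrier := A\<rparr>)" "bij_betw h (carrier M) A"
    using assms unfolding direct_summand_def internal_direct_sum_def mod_isomorphic_def by auto
  interpret M: left_module R M by fact
  interpret N: left_module R N by fact
  note A = submoduleD[OF sub(1)] and B = submoduleD[OF sub(2)]
  define P where "P x = (THE a. a \<in> A \<and> (\<exists>b\<in>B. x = a \<oplus>\<^bsub>N\<^esub> b))" for x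
  \<comment> \<open>The component in \<open>A\<close> is unique: \<open>a + b = c + d\<close> gives
    \<open>-c + a = d - b\<close>, an element of both \<open>A\<close> and \<open>B\<close> and
    hence zero.\<close>
  have P: "P x = a" if "a \<in> A" "b \<in> B" "x = a \<oplus>\<^bsub>N\<^esub> b" for x a b
    unfolding P_def
  proof (rule the_equality)
    fix c assume "c \<in> A \<and> (\<exists>b\<in>B. x = c \<oplus>\<^bsub>N\<^esub> b)"
    then obtain d where c: "c \<in> A" "d \<in> B" "x = c \<oplus>\<^bsub>N\<^esub> d" by auto
    have m: "a \<in> carrier N" "b \<in> carrier N" "c \<in> carrier N" "d \<in> carrier N"
      using c that A B by auto
    have "\<ominus>\<^bsub>N\<^esub> c \<oplus>\<^bsub>N\<^esub> a = \<ominus>\<^bsub>N\<^esub> c \<oplus>\<^bsub>N\<^esub> (a \<oplus>\<^bsub>N\<^esub> b) \<oplus>\<^bsub>N\<^esub> \<ominus>\<^bsub>N\<^esub> b"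
      using m by (simp add: N.M.a_assoc N.M.r_neg)
    also have "\<dots> = \<ominus>\<^bsub>N\<^esub> c \<oplus>\<^bsub>N\<^esub> (c \<oplus>\<^bsub>N\<^esub> d) \<oplus>\<^bsub>N\<^esub> \<ominus>\<^bsub>N\<^esub> b"
      using that(3) c(3) by simp
    also have "\<dots> = d \<oplus>\<^bsub>N\<^esub> \<ominus>\<^bsub>N\<^esub> b"
      using m by (simp add: N.M.l_neg flip: N.M.a_assoc)
    finally have "\<ominus>\<^bsub>N\<^esub> c \<oplus>\<^bsub>N\<^esub> a \<in> A \<inter> B"
      using that c A B by (metis IntI)
    then have "\<ominus>\<^bsub>N\<^esub> c \<oplus>\<^bsub>N\<^esub> a = \<zero>\<^bsub>N\<^esub>" using int by auto
    then show "c = a"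
      using N.M.minus_equality[of "\<ominus>\<^bsub>N\<^esub> c" a] N.M.minus_minus m N.M.a_comm
      by (metis N.M.a_inv_closed)
  qed (use that in auto)
  have ex: "\<exists>a\<in>A. \<exists>b\<in>B. x = a \<oplus>\<^bsub>N\<^esub> b" if "x \<in> carrier N" for x
    using that equalityD2[OF sum] unfolding set_add_def set_mult_def by (simp add: subset_iff)
  have Phom: "P \<in> mod_hom R N (N\<lparr>carrier := A\<rparr>)"
  proof (rule mod_homI)
    show "P x \<in> carrier (N\<lparr>carrier := A\<rparr>)" if "x \<in> carrier N" for x
      using ex[OF that] P by auto
  next
    fix x y assume "x \<in> carrier N" "y \<in> carrier N"
    then obtain a b c d where xy: "a \<in> A" "b \<in> B" "x = a \<oplus>\<^bsub>N\<^esub> b" "c \<in> A" "d \<in> B" "y = c \<oplus>\<^bsub>N\<^esub> d"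
      using ex by metis
    then have m: "a \<in> carrier N" "b \<in> carrier N" "c \<in> carrier N" "d \<in> carrier N"
      using A B by auto
    have "x \<oplus>\<^bsub>N\<^esub> y = (a \<oplus>\<^bsub>N\<^esub> c) \<oplus>\<^bsub>N\<^esub> (b \<oplus>\<^bsub>N\<^esub> d)"
      using m xy by (simp add: N.M.a_ac)
    then have "P (x \<oplus>\<^bsub>N\<^esub> y) = a \<oplus>\<^bsub>N\<^esub> c"
      using xy A B by (intro P) auto
    then show "P (x \<oplus>\<^bsub>N\<^esub> y) = P x \<oplus>\<^bsub>N\<lparr>carrier := A\<rparr>\<^esub> P y"
      using xy P by auto
  next
    fix r x assume r: "r \<in> carrier R" "x \<in> carrier N"
    then obtain a b where x: "a \<in> A" "b \<in> B" "x = a \<oplus>\<^bsub>N\<^esub> b"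
      using ex by metis
    then have "P (r \<odot>\<^bsub>N\<^esub> x) = r \<odot>\<^bsub>N\<^esub> a"
      using r A B by (intro P[of _ "r \<odot>\<^bsub>N\<^esub> b"]) (auto intro!: N.smult_r_distr)
    then show "P (r \<odot>\<^bsub>N\<^esub> x) = r \<odot>\<^bsub>N\<lparr>carrier := A\<rparr>\<^esub> P x"
      using x P by auto
  qed
  let ?k = "inv_into (carrier M) h"
  have k: "?k \<in> mod_hom R (N\<lparr>carrier := A\<rparr>) M"
    using mod_hom_inv_into[OF M h(1)] h(2) by simp
  have hA: "h x \<in> A" if "x \<in> carrier M" for x
    using mod_hom_closed[OF h(1) that] by simp
  have "P (h x) = h x" if "x \<in> carrier M" for x
    using hA[OF that] A B by (intro P[of _ "\<zero>\<^bsub>N\<^esub>"]) auto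
  then have "(?k \<circ> P) (h x) = x" if "x \<in> carrier M" for x
    using that h(2) by (simp add: bij_betw_def)
  moreover have "h \<in> mod_hom R M N"
    using h(1) A(1) by (auto simp: mod_hom_def hom_def)
  ultimately show ?thesis
    using that[OF M N _ mod_hom_compose[OF Phom k]] by blast
qed


section \<open>Direct sums\<close>

lemma zero_direct_sum: "\<zero>\<^bsub>direct_sum I F\<^esub> = (\<lambda>i\<in>I. \<zero>\<^bsub>F i\<^esub>)"
  and add_direct_sum: "x \<oplus>\<^bsub>direct_sum I F\<^esub> y = (\<lambda>i\<in>I. x i \<oplus>\<^bsub>F i\<^esub> y i)"
  and smult_direct_sum: "a \<odot>\<^bsub>direct_sum I F\<^esub> x = (\<lambda>i\<in>I. a \<odot>\<^bsub>F i\<^esub> x i)"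
  by (simp_all add: direct_sum_def Let_def)

lemmas direct_sum_ops = zero_direct_sum add_direct_sum smult_direct_sum

lemma direct_sum_apply [simp]:
  assumes "i \<in> I"
  shows "\<zero>\<^bsub>direct_sum I F\<^esub> i = \<zero>\<^bsub>F i\<^esub>"
    and "(x \<oplus>\<^bsub>direct_sum I F\<^esub> y) i = x i \<oplus>\<^bsub>F i\<^esub> y i"
    and "(a \<odot>\<^bsub>direct_sum I F\<^esub> x) i = a \<odot>\<^bsub>F i\<^esub> x i"
  using assms by (simp_all add: direct_sum_ops)

lemma carrier_direct_sum:
  assumes "\<And>i. i \<in> I \<Longrightarrow> left_module R (F i)"
  shows "carrier (direct_sum I F) =
    {x \<in> \<Pi>\<^sub>E i\<in>I. carrier (F i). finite {i \<in> I. x i \<noteq> \<zero>\<^bsub>F i\<^esub>}}"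
proof -
  have "group (add_monoid (F i))" if "i \<in> I" for i
    using assms[OF that] by (simp add: left_module_def abelian_group.a_group)
  then show ?thesis
    by (simp add: direct_sum_def Let_def carrier_sum_group)
qed

lemma left_module_direct_sum:
  assumes "ring R" and F: "\<And>i. i \<in> I \<Longrightarrow> left_module R (F i)"
  shows "left_module R (direct_sum I F)"
proof -
  have "group (add_monoid (F i))" if "i \<in> I" for i
    using F[OF that] by (simp add: left_module_def abelian_group.a_group)
  then have "group (sum_group I (\<lambda>i. add_monoid (F i)))" by simp
  \<comment> \<open>The additive monoid of the direct sum and \<open>sum_group\<close> are different
    records that agree in carrier, operation and unit; the group axioms are carried over by
    unfolding them.\<close>
  then have g: "group (add_monoid (direct_sum I F))"
    unfolding group_def monoid_def group_axioms_def Units_def by (simp add: direct_sum_def Let_def)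
  have "comm_group (add_monoid (direct_sum I F))"
    using g F
    by (intro group.group_comm_groupI)
      (auto simp: carrier_direct_sum[OF F] PiE_iff direct_sum_ops intro!: restrict_ext abelian_monoid.a_comm
        abelian_group.axioms(1) left_module.axioms(2)[OF F])
  then have ag: "abelian_group (direct_sum I F)"
    by (auto simp: abelian_group_def abelian_group_axioms_def comm_group_def intro!: abelian_monoid.intro)
  \<comment> \<open>Scalar multiplication does not enlarge the support, because \<open>a\<close>
    times zero is zero.\<close>
  have fin: "finite {i \<in> I. a \<odot>\<^bsub>F i\<^esub> x i \<noteq> \<zero>\<^bsub>F i\<^esub>}"
    if "a \<in> carrier R" "finite {i \<in> I. x i \<noteq> \<zero>\<^bsub>F i\<^esub>}" for a x
    using that(2) by (rule rev_finite_subset) (auto simp: left_module.smult_r_null[OF F that(1)])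
  have mem: "x i \<in> carrier (F i)" if "x \<in> carrier (direct_sum I F)" "i \<in> I" for x i
    using that by (auto simp: carrier_direct_sum[OF F])
  show ?thesis
  proof (intro left_module.intro left_module_axioms.intro)
    show "a \<odot>\<^bsub>direct_sum I F\<^esub> x \<in> carrier (direct_sum I F)"
      if "a \<in> carrier R" "x \<in> carrier (direct_sum I F)" for a x
    proof -
      have "{i \<in> I. (a \<odot>\<^bsub>direct_sum I F\<^esub> x) i \<noteq> \<zero>\<^bsub>F i\<^esub>} = {i \<in> I. a \<odot>\<^bsub>F i\<^esub> x i \<noteq> \<zero>\<^bsub>F i\<^esub>}"
        by auto
      then show ?thesis
        using that fin[of a x] mem[OF that(2)] left_module.smult_closed[OF F]
        by (auto simp: carrier_direct_sum[OF F] smult_direct_sum)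
    qed
    show "\<one>\<^bsub>R\<^esub> \<odot>\<^bsub>direct_sum I F\<^esub> x = x" if "x \<in> carrier (direct_sum I F)" for x
    proof (rule extensionalityI[of _ I])
      show "x \<in> extensional I"
        using that by (simp add: carrier_direct_sum[OF F] PiE_iff)
    qed (use mem[OF that] left_module.smult_one[OF F] in \<open>auto simp: smult_direct_sum\<close>)
  next
    show "(a \<oplus>\<^bsub>R\<^esub> b) \<odot>\<^bsub>direct_sum I F\<^esub> x =
        a \<odot>\<^bsub>direct_sum I F\<^esub> x \<oplus>\<^bsub>direct_sum I F\<^esub> b \<odot>\<^bsub>direct_sum I F\<^esub> x"
      if "a \<in> carrier R" "b \<in> carrier R" "x \<in> carrier (direct_sum I F)" for a b x
      unfolding direct_sum_ops
      by (rule restrict_ext) (simp add: left_module.smult_l_distr[OF F] mem that)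
    show "a \<odot>\<^bsub>direct_sum I F\<^esub> (x \<oplus>\<^bsub>direct_sum I F\<^esub> y) =
        a \<odot>\<^bsub>direct_sum I F\<^esub> x \<oplus>\<^bsub>direct_sum I F\<^esub> a \<odot>\<^bsub>direct_sum I F\<^esub> y"
      if "a \<in> carrier R" "x \<in> carrier (direct_sum I F)" "y \<in> carrier (direct_sum I F)" for a x y
      unfolding direct_sum_ops
      by (rule restrict_ext) (simp add: left_module.smult_r_distr[OF F] mem that)
    show "(a \<otimes>\<^bsub>R\<^esub> b) \<odot>\<^bsub>direct_sum I F\<^esub> x =
        a \<odot>\<^bsub>direct_sum I F\<^esub> (b \<odot>\<^bsub>direct_sum I F\<^esub> x)"
      if "a \<in> carrier R" "b \<in> carrier R" "x \<in> carrier (direct_sum I F)" for a b x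
      unfolding direct_sum_ops
      by (rule restrict_ext) (simp add: left_module.smult_assoc1[OF F] mem that)
  qed (rule assms(1) ag)+
qed

section \<open>Universal property of the direct sum\<close>

definition ds_inj :: "'i set \<Rightarrow> ('i \<Rightarrow> ('a, 'u, 'm) module_scheme) \<Rightarrow> 'i \<Rightarrow> 'u \<Rightarrow> ('i \<Rightarrow> 'u)" where
  "ds_inj I F i u = (\<lambda>j\<in>I. if j = i then u else \<zero>\<^bsub>F j\<^esub>)"

lemma ds_inj_apply: "j \<in> I \<Longrightarrow> ds_inj I F i u j = (if j = i then u else \<zero>\<^bsub>F j\<^esub>)"
  by (simp add: ds_inj_def)

locale module_family =
  fixes R :: "('a, 'r) ring_scheme" and I :: "'i set" and F :: "'i \<Rightarrow> ('a, 'u, 'm) module_scheme"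
  assumes ring: "ring R" and module: "\<And>i. i \<in> I \<Longrightarrow> left_module R (F i)"
begin

abbreviation "D \<equiv> direct_sum I F"

sublocale D: left_module R D
  by (rule left_module_direct_sum[OF ring module])

lemma carrier: "carrier D = {x \<in> \<Pi>\<^sub>E i\<in>I. carrier (F i). finite {i \<in> I. x i \<noteq> \<zero>\<^bsub>F i\<^esub>}}"
  by (rule carrier_direct_sum[OF module])

lemma module_zero_closed: "i \<in> I \<Longrightarrow> \<zero>\<^bsub>F i\<^esub> \<in> carrier (F i)"
  using module by (meson abelian_group.axioms(1) abelian_monoid.zero_closed left_module_def)

lemma ds_inj_hom:
  assumes "i \<in> I"
  shows "ds_inj I F i \<in> mod_hom R (F i) D"
proof -
  interpret left_module R "F i" by (rule module[OF assms])
  have cl: "ds_inj I F i u \<in> carrier D" if "u \<in> carrier (F i)" for u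
    using that assms module_zero_closed
    by (auto simp: carrier ds_inj_def intro: rev_finite_subset[of "{i}"])
  have Fz: "\<zero>\<^bsub>F j\<^esub> \<oplus>\<^bsub>F j\<^esub> \<zero>\<^bsub>F j\<^esub> = \<zero>\<^bsub>F j\<^esub>" if "j \<in> I" for j
    using module[OF that] module_zero_closed[OF that]
    by (meson abelian_group.axioms(1) abelian_monoid.l_zero left_module_def)
  have Fs: "a \<odot>\<^bsub>F j\<^esub> \<zero>\<^bsub>F j\<^esub> = \<zero>\<^bsub>F j\<^esub>" if "j \<in> I" "a \<in> carrier R" for j a
    using left_module.smult_r_null[OF module] that by blast
  show ?thesis
    using cl by (intro mod_homI) (auto simp: ds_inj_def direct_sum_ops Fz Fs intro!: restrict_ext)
qed

lemma ds_proj_hom: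
  assumes "i \<in> I"
  shows "(\<lambda>x. x i) \<in> mod_hom R D (F i)"
  using assms by (intro mod_homI) (auto simp: carrier)

text \<open>An element of finite support is a finite sum of elements concentrated in one coordinate.
  The induction runs over a finite set \<open>K\<close> outside which \<open>x\<close> vanishes, and
  each step splits off the coordinate \<open>k\<close>.\<close>

lemma ds_induct [consumes 1, case_names zero inj add]:
  assumes x: "x \<in> carrier D"
    and zero: "P \<zero>\<^bsub>D\<^esub>"
    and inj: "\<And>i u. i \<in> I \<Longrightarrow> u \<in> carrier (F i) \<Longrightarrow> P (ds_inj I F i u)"
    and add: "\<And>x y. x \<in> carrier D \<Longrightarrow> y \<in> carrier D \<Longrightarrow> P x \<Longrightarrow> P y \<Longrightarrow> P (x \<oplus>\<^bsub>D\<^esub> y)"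
  shows "P x"
proof -
  have "P x" if "finite K" "K \<subseteq> I" "x \<in> carrier D" "\<forall>i\<in>I - K. x i = \<zero>\<^bsub>F i\<^esub>" for K x
    using that
  proof (induction K arbitrary: x rule: finite_induct)
    case empty
    then have "x = \<zero>\<^bsub>D\<^esub>"
      by (auto simp: carrier PiE_def extensional_def direct_sum_ops)
    then show ?case using zero by simp
  next
    case (insert k K)
    let ?y = "\<lambda>i\<in>I. if i = k then \<zero>\<^bsub>F i\<^esub> else x i"
    let ?z = "ds_inj I F k (x k)"
    have k: "k \<in> I" and xk: "x k \<in> carrier (F k)"
      using insert.prems by (auto simp: carrier)
    have y: "?y \<in> carrier D"
      using insert.prems module_zero_closed
      by (auto simp: carrier intro: rev_finite_subset[of "{i \<in> I. x i \<noteq> \<zero>\<^bsub>F i\<^esub>}"])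
    have z: "?z \<in> carrier D"
      using mod_hom_closed[OF ds_inj_hom[OF k] xk] .
    have "x i = ?z i \<oplus>\<^bsub>F i\<^esub> ?y i" if "i \<in> I" for i
    proof -
      interpret left_module R "F i" by (rule module[OF that])
      have "x i \<oplus>\<^bsub>F i\<^esub> \<zero>\<^bsub>F i\<^esub> = x i" "\<zero>\<^bsub>F i\<^esub> \<oplus>\<^bsub>F i\<^esub> x i = x i"
        using insert.prems(2) that by (simp_all add: carrier PiE_iff)
      then show ?thesis using that by (auto simp: ds_inj_apply)
    qed
    then have "x = ?z \<oplus>\<^bsub>D\<^esub> ?y"
      using insert.prems(2)
      by (intro extensionalityI[of _ I]) (simp_all add: carrier direct_sum_ops PiE_iff)
    moreover have "P ?y"
      using insert.prems by (intro insert.IH y) auto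
    ultimately show ?case
      using add[OF z y] inj[OF k xk] by simp
  qed
  moreover have "finite {i \<in> I. x i \<noteq> \<zero>\<^bsub>F i\<^esub>}"
    using x by (simp add: carrier)
  ultimately show ?thesis
    using x by blast
qed

text \<open>By \<open>ds_induct\<close>, agreement on the single summands extends additively to all
  of \<open>D\<close>. This is the uniqueness half of the universal property.\<close>

lemma ds_hom_eq:
  assumes "left_module R N" "h \<in> mod_hom R D N" "k \<in> mod_hom R D N"
    and "\<And>i u. i \<in> I \<Longrightarrow> u \<in> carrier (F i) \<Longrightarrow> h (ds_inj I F i u) = k (ds_inj I F i u)"
    and "x \<in> carrier D"
  shows "h x = k x"
  using assms(5)
proof (induction rule: ds_induct)
  case zero
  then show ?case
    using mod_hom_zero[OF D.left_module_axioms assms(1)] assms(2,3) by metis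
next
  case (add x y)
  then show ?case
    using mod_hom_add[OF assms(2)] mod_hom_add[OF assms(3)] by simp
qed (use assms in auto)

text \<open>The homomorphism that the universal property assigns to the family \<open>h\<close>.
  Summing over the support of \<open>x\<close> keeps the index set finite even when \<open>I\<close>
  is infinite.\<close>

definition ds_lift :: "('a, 'v, 'n) module_scheme \<Rightarrow> ('i \<Rightarrow> 'u \<Rightarrow> 'v) \<Rightarrow> ('i \<Rightarrow> 'u) \<Rightarrow> 'v" where
  "ds_lift N h x = (\<Oplus>\<^bsub>N\<^esub>i\<in>{i \<in> I. x i \<noteq> \<zero>\<^bsub>F i\<^esub>}. h i (x i))"

context
  fixes N :: "('a, 'v, 'n) module_scheme" and h
  assumes N: "left_module R N" and h: "\<And>i. i \<in> I \<Longrightarrow> h i \<in> mod_hom R (F i) N"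
begin

text \<open>Enlarging the index set beyond the support only adds terms in which \<open>h i\<close>
  is applied to zero. Elements with different supports can thus be summed over a common set.\<close>

lemma ds_lift_eq_finsum:
  assumes "x \<in> carrier D" "finite K" "K \<subseteq> I" "{i \<in> I. x i \<noteq> \<zero>\<^bsub>F i\<^esub>} \<subseteq> K"
  shows "ds_lift N h x = (\<Oplus>\<^bsub>N\<^esub>i\<in>K. h i (x i))"
proof -
  interpret N: left_module R N by (rule N)
  show ?thesis
    unfolding ds_lift_def
  proof (rule N.M.add.finprod_mono_neutral_cong_left)
    have "x i \<in> carrier (F i)" if "i \<in> I" for i
      using assms(1) that by (simp add: carrier PiE_iff)
    then show "(\<lambda>i. h i (x i)) \<in> K \<rightarrow> carrier N"
      using mod_hom_closed[OF h] assms(3) by blast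
  qed (use assms mod_hom_zero[OF module N h] in auto)
qed

lemma ds_lift_inj:
  assumes "i \<in> I" "u \<in> carrier (F i)"
  shows "ds_lift N h (ds_inj I F i u) = h i u"
proof -
  interpret N: left_module R N by (rule N)
  have "ds_lift N h (ds_inj I F i u) = (\<Oplus>\<^bsub>N\<^esub>j\<in>{i}. h j (ds_inj I F i u j))"
    using assms mod_hom_closed[OF ds_inj_hom]
    by (intro ds_lift_eq_finsum) (auto simp: ds_inj_apply split: if_splits)
  then show ?thesis
    using assms mod_hom_closed[OF h] by (simp add: ds_inj_apply)
qed

lemma ds_lift_hom: "ds_lift N h \<in> mod_hom R D N"
proof -
  interpret N: left_module R N by (rule N)
  have cl: "ds_lift N h x \<in> carrier N" if "x \<in> carrier D" for x
    unfolding ds_lift_def using that mod_hom_closed[OF h]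
    by (intro N.M.finsum_closed) (auto simp: carrier)
  have ladd: "ds_lift N h (x \<oplus>\<^bsub>D\<^esub> y) = ds_lift N h x \<oplus>\<^bsub>N\<^esub> ds_lift N h y"
    if xy: "x \<in> carrier D" "y \<in> carrier D" for x y
  proof -
    \<comment> \<open>A common finite index set for \<open>x\<close>, \<open>y\<close> and
      \<open>x + y\<close>: where both summands vanish, so does their sum.\<close>
    define K where "K = {i \<in> I. x i \<noteq> \<zero>\<^bsub>F i\<^esub>} \<union> {i \<in> I. y i \<noteq> \<zero>\<^bsub>F i\<^esub>}"
    have K: "finite K" "K \<subseteq> I" using xy by (auto simp: K_def carrier)
    have x: "ds_lift N h x = (\<Oplus>\<^bsub>N\<^esub>i\<in>K. h i (x i))"
      using xy K by (intro ds_lift_eq_finsum) (auto simp: K_def)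
    have y: "ds_lift N h y = (\<Oplus>\<^bsub>N\<^esub>i\<in>K. h i (y i))"
      using xy K by (intro ds_lift_eq_finsum) (auto simp: K_def)
    have z: "\<zero>\<^bsub>F i\<^esub> \<oplus>\<^bsub>F i\<^esub> \<zero>\<^bsub>F i\<^esub> = \<zero>\<^bsub>F i\<^esub>" if "i \<in> I" for i
      using module[OF that] module_zero_closed[OF that]
      by (meson abelian_group.axioms(1) abelian_monoid.l_zero left_module_def)
    have "ds_lift N h (x \<oplus>\<^bsub>D\<^esub> y) = (\<Oplus>\<^bsub>N\<^esub>i\<in>K. h i ((x \<oplus>\<^bsub>D\<^esub> y) i))"
      using xy K z by (intro ds_lift_eq_finsum D.M.a_closed) (auto simp: K_def)
    also have "\<dots> = (\<Oplus>\<^bsub>N\<^esub>i\<in>K. h i (x i) \<oplus>\<^bsub>N\<^esub> h i (y i))"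
      using xy K mod_hom_closed[OF h] mod_hom_add[OF h]
      by (intro N.M.add.finprod_cong') (auto simp: carrier PiE_iff subset_eq)
    also have "\<dots> = ds_lift N h x \<oplus>\<^bsub>N\<^esub> ds_lift N h y"
      unfolding x y using xy K mod_hom_closed[OF h]
      by (intro N.M.finsum_addf) (auto simp: carrier PiE_iff subset_eq)
    finally show ?thesis .
  qed
  \<comment> \<open>Induction over \<open>x\<close> avoids comparing the supports of
    \<open>x\<close> and its multiple: on one coordinate the claim is linearity of
    \<open>h i\<close>, and sums are covered by additivity.\<close>
  have "ds_lift N h (a \<odot>\<^bsub>D\<^esub> x) = a \<odot>\<^bsub>N\<^esub> ds_lift N h x" if "x \<in> carrier D" "a \<in> carrier R" for a x
    using that(1)
  proof (induction rule: ds_induct)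
    case zero
    have "ds_lift N h \<zero>\<^bsub>D\<^esub> = \<zero>\<^bsub>N\<^esub>"
      using ladd[of "\<zero>\<^bsub>D\<^esub>" "\<zero>\<^bsub>D\<^esub>"] cl[of "\<zero>\<^bsub>D\<^esub>"] N.M.add.l_cancel_one'[of "ds_lift N h \<zero>\<^bsub>D\<^esub>" "ds_lift N h \<zero>\<^bsub>D\<^esub>"]
        D.M.zero_closed D.M.l_zero by metis
    then show ?case
      using that(2) by simp
  next
    case (inj i u)
    interpret left_module R "F i" by (rule module[OF inj(1)])
    have "a \<odot>\<^bsub>D\<^esub> ds_inj I F i u = ds_inj I F i (a \<odot>\<^bsub>F i\<^esub> u)"
      by (rule mod_hom_smult[OF ds_inj_hom, symmetric]) (use inj that in auto)
    then show ?case
      using inj that(2) by (simp add: ds_lift_inj mod_hom_smult[OF h])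
  next
    case (add x y)
    have "ds_lift N h (a \<odot>\<^bsub>D\<^esub> (x \<oplus>\<^bsub>D\<^esub> y)) = ds_lift N h (a \<odot>\<^bsub>D\<^esub> x \<oplus>\<^bsub>D\<^esub> a \<odot>\<^bsub>D\<^esub> y)"
      by (simp only: D.smult_r_distr[OF that(2) add(1,2)])
    also have "\<dots> = ds_lift N h (a \<odot>\<^bsub>D\<^esub> x) \<oplus>\<^bsub>N\<^esub> ds_lift N h (a \<odot>\<^bsub>D\<^esub> y)"
      by (rule ladd) (intro D.smult_closed that(2) add(1,2))+
    also have "\<dots> = a \<odot>\<^bsub>N\<^esub> (ds_lift N h x \<oplus>\<^bsub>N\<^esub> ds_lift N h y)"
      by (simp only: add(3,4) N.smult_r_distr[OF that(2) cl[OF add(1)] cl[OF add(2)]])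
    finally show ?case
      by (simp only: ladd[OF add(1,2)])
  qed
  then show ?thesis
    by (intro mod_homI cl ladd)
qed

end

end


section \<open>Cardinality bounds and free modules\<close>

text \<open>HOL-Algebra uses the same symbol for inclusions of rings.\<close>

no_notation iso_incl (infixl "\<lesssim>" 65)

lemma lepoll_iff_card_of_ordLeq: "A \<lesssim> B \<longleftrightarrow> (card_of A, card_of B) \<in> ordLeq"
  by (simp add: lepoll_def card_of_ordLeq)

lemma Sigma_lepoll_infinite:
  assumes "infinite U" "I \<lesssim> U" "\<And>i. i \<in> I \<Longrightarrow> A i \<lesssim> U"
  shows "Sigma I A \<lesssim> U"
  using assms card_of_Sigma_ordLeq_infinite[of U I A] by (auto simp: lepoll_iff_card_of_ordLeq)

text \<open>Infinite cardinals absorb products, so by induction the lists of each fixed length are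
  no more numerous than \<open>U\<close>; and there are only countably many lengths.\<close>

lemma lists_lepoll_infinite:
  assumes "infinite U" "A \<lesssim> U"
  shows "lists A \<lesssim> U"
proof -
  have *: "{xs \<in> lists A. length xs = n} \<lesssim> U" for n
  proof (induction n)
    case 0
    have "{xs \<in> lists A. length xs = 0} = {[]}" by auto
    then show ?case using assms(1) by (simp add: finite_lepoll_infinite)
  next
    case (Suc n)
    have "{xs \<in> lists A. length xs = Suc n} \<subseteq>
        (\<lambda>(x, xs). x # xs) ` (A \<times> {xs \<in> lists A. length xs = n})"
      by (auto simp: length_Suc_conv image_iff)
    then have "{xs \<in> lists A. length xs = Suc n} \<lesssim> A \<times> {xs \<in> lists A. length xs = n}"
      by (rule subset_image_lepoll)
    also have "\<dots> \<lesssim> U"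
      using assms Suc by (intro Sigma_lepoll_infinite)
    finally show ?case .
  qed
  have "lists A \<subseteq> snd ` (SIGMA n:UNIV. {xs \<in> lists A. length xs = n})"
    by (force simp: image_iff)
  then have "lists A \<lesssim> (SIGMA n:UNIV. {xs \<in> lists A. length xs = n})"
    by (rule subset_image_lepoll)
  also have "\<dots> \<lesssim> U"
    using * assms(1) infinite_le_lepoll by (intro Sigma_lepoll_infinite) auto
  finally show ?thesis .
qed

text \<open>An element of finite support is encoded by a list of its nonzero entries, paired with
  their indices. As \<open>?r\<close> decodes such lists, the direct sum lies in an image of
  \<open>lists ?S\<close>.\<close>

lemma direct_sum_lepoll:
  assumes "infinite U" "I \<lesssim> U" "\<And>i. i \<in> I \<Longrightarrow> left_module R (F i)"
    "\<And>i. i \<in> I \<Longrightarrow> carrier (F i) \<lesssim> U"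
  shows "carrier (direct_sum I F) \<lesssim> U"
proof -
  let ?S = "SIGMA i:I. carrier (F i)"
  \<comment> \<open>\<open>THE\<close> is meaningful when the list enumerates the graph of a
    function, which holds for the lists used below; indices that do not occur get the default value
    zero.\<close>
  let ?r = "\<lambda>L. \<lambda>i\<in>I. if \<exists>u. (i, u) \<in> set L then THE u. (i, u) \<in> set L else \<zero>\<^bsub>F i\<^esub>"
  have "x \<in> ?r ` lists ?S" if "x \<in> carrier (direct_sum I F)" for x
  proof -
    let ?K = "{i \<in> I. x i \<noteq> \<zero>\<^bsub>F i\<^esub>}"
    have x: "x \<in> (\<Pi>\<^sub>E i\<in>I. carrier (F i))" "finite ?K"
      using that by (simp_all add: carrier_direct_sum[of I R F, OF assms(3)])
    obtain L where L: "set L = (\<lambda>i. (i, x i)) ` ?K"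
      using finite_list[OF finite_imageI[OF x(2), of "\<lambda>i. (i, x i)"]] by metis
    have "set L \<subseteq> ?S"
      using x(1) by (simp add: L PiE_iff image_subset_iff)
    then have "L \<in> lists ?S" by (simp add: lists_eq_set)
    moreover have "x = ?r L"
    proof (rule extensionalityI[of _ I])
      show "x \<in> extensional I" using x(1) by (simp add: PiE_iff)
      show "x i = ?r L i" if "i \<in> I" for i
        using that unfolding L by (simp add: image_iff)
    qed simp
    ultimately show ?thesis by blast
  qed
  then have "carrier (direct_sum I F) \<lesssim> lists ?S"
    by (meson subset_image_lepoll subsetI)
  also have "\<dots> \<lesssim> U"
    using assms by (intro lists_lepoll_infinite Sigma_lepoll_infinite)
  finally show ?thesis .
qed

section \<open>Free modules of finite rank\<close>

lemma regular_module_simps [simp]: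
  "carrier (regular_module R) = carrier R" "\<zero>\<^bsub>regular_module R\<^esub> = \<zero>\<^bsub>R\<^esub>"
  "x \<oplus>\<^bsub>regular_module R\<^esub> y = x \<oplus>\<^bsub>R\<^esub> y" "a \<odot>\<^bsub>regular_module R\<^esub> x = a \<otimes>\<^bsub>R\<^esub> x"
  by (simp_all add: regular_module_def)

abbreviation free_module :: "('a, 'r) ring_scheme \<Rightarrow> nat \<Rightarrow> ('a, nat \<Rightarrow> 'a) module" where
  "free_module R n \<equiv> direct_sum {..<n} (\<lambda>_. regular_module R)"

abbreviation unit_vec :: "('a, 'r) ring_scheme \<Rightarrow> nat \<Rightarrow> nat \<Rightarrow> (nat \<Rightarrow> 'a)" where
  "unit_vec R n i \<equiv> ds_inj {..<n} (\<lambda>_. regular_module R) i \<one>\<^bsub>R\<^esub>"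

lemma module_family_regular: "ring R \<Longrightarrow> module_family R I (\<lambda>_. regular_module R)"
  by (simp add: module_family_def left_module_regular_module)

text \<open>The element with entry \<open>u\<close> in coordinate \<open>i\<close> and zero
  elsewhere is \<open>u\<close> times the \<open>i\<close>-th unit vector, so the values at the unit
  vectors fix a homomorphism on every summand.\<close>

lemma free_module_hom_eq:
  assumes "ring R" "left_module R N" "h \<in> mod_hom R (free_module R n) N"
    "k \<in> mod_hom R (free_module R n) N" "\<And>i. i < n \<Longrightarrow> h (unit_vec R n i) = k (unit_vec R n i)"
    "x \<in> carrier (free_module R n)"
  shows "h x = k x"
proof -
  interpret module_family R "{..<n}" "\<lambda>_. regular_module R"
    using assms(1) by (rule module_family_regular)
  interpret R: ring R by fact
  show ?thesis
  proof (rule ds_hom_eq[OF assms(2-4) _ assms(6)])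
    fix i u assume iu: "i \<in> {..<n}" "u \<in> carrier (regular_module R)"
    have e: "unit_vec R n i \<in> carrier D"
      using mod_hom_closed[OF ds_inj_hom[OF iu(1)], of "\<one>\<^bsub>R\<^esub>"] by simp
    have "ds_inj {..<n} (\<lambda>_. regular_module R) i u = u \<odot>\<^bsub>D\<^esub> unit_vec R n i"
      using mod_hom_smult[OF ds_inj_hom[OF iu(1)], of u "\<one>\<^bsub>R\<^esub>"] iu by simp
    then show "h (ds_inj {..<n} (\<lambda>_. regular_module R) i u) = k (ds_inj {..<n} (\<lambda>_. regular_module R) i u)"
      using iu e assms(5) mod_hom_smult[OF assms(3) _ e] mod_hom_smult[OF assms(4) _ e] by simp
  qed
qed

text \<open>Reading off the \<open>n\<close> values at the unit vectors embeds the homomorphisms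
  into the lists over \<open>N\<close>. Extensionality rules out functions that differ only off the
  carrier.\<close>

lemma free_module_hom_lepoll:
  assumes "ring R" "left_module R N" "infinite U" "carrier N \<lesssim> U"
  shows "mod_hom R (free_module R n) N \<inter> extensional (carrier (free_module R n)) \<lesssim> U"
    (is "?H \<lesssim> U")
proof -
  interpret module_family R "{..<n}" "\<lambda>_. regular_module R"
    using assms(1) by (rule module_family_regular)
  interpret R: ring R by fact
  let ?e = "\<lambda>h. map (\<lambda>i. h (unit_vec R n i)) [0..<n]"
  have e: "unit_vec R n i \<in> carrier D" if "i < n" for i
    using mod_hom_closed[OF ds_inj_hom[of i], of "\<one>\<^bsub>R\<^esub>"] that by simp
  have "inj_on ?e ?H"
  proof (rule inj_onI)
    fix h k assume *: "h \<in> ?H" "k \<in> ?H" "?e h = ?e k"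
    show "h = k"
    proof (rule extensionalityI[of _ "carrier D"])
      show "h x = k x" if "x \<in> carrier D" for x
      proof (rule free_module_hom_eq[OF assms(1,2) _ _ _ that])
        show "h (unit_vec R n i) = k (unit_vec R n i)" if "i < n" for i
          using *(3) that by simp
      qed (use *(1,2) in simp_all)
    qed (use *(1,2) in simp_all)
  qed
  moreover have "?e ` ?H \<subseteq> lists (carrier N)"
    using e mod_hom_closed by fastforce
  ultimately have "?H \<lesssim> lists (carrier N)"
    unfolding lepoll_def by blast
  also have "\<dots> \<lesssim> U"
    using assms by (intro lists_lepoll_infinite)
  finally show ?thesis .
qed

text \<open>\<open>J\<close> is the union of the finite supports of the images of the unit vectors.
  For \<open>i\<close> outside \<open>J\<close>, the \<open>i\<close>-th component of
  \<open>h\<close> is a homomorphism that vanishes on all unit vectors and hence is zero.\<close>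

lemma free_module_hom_finite_support:
  assumes "ring R" "\<And>i. i \<in> I \<Longrightarrow> left_module R (F i)" "h \<in> mod_hom R (free_module R n) (direct_sum I F)"
  obtains J where "finite J" "J \<subseteq> I"
    "\<And>x i. x \<in> carrier (free_module R n) \<Longrightarrow> i \<in> I - J \<Longrightarrow> h x i = \<zero>\<^bsub>F i\<^esub>"
proof -
  interpret R: ring R by fact
  interpret rf: module_family R "{..<n}" "\<lambda>_. regular_module R"
    using assms(1) by (rule module_family_regular)
  interpret f: module_family R I F
    by (rule module_family.intro[OF assms(1,2)])
  have e: "unit_vec R n i \<in> carrier (free_module R n)" if "i < n" for i
    using mod_hom_closed[OF rf.ds_inj_hom[of i], of "\<one>\<^bsub>R\<^esub>"] that by simp
  define J where "J = (\<Union>j<n. {i \<in> I. h (unit_vec R n j) i \<noteq> \<zero>\<^bsub>F i\<^esub>})"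
  show ?thesis
  proof (rule that[of J])
    have "finite {i \<in> I. h (unit_vec R n j) i \<noteq> \<zero>\<^bsub>F i\<^esub>}" if "j < n" for j
      using mod_hom_closed[OF assms(3) e[OF that]] by (simp add: f.carrier)
    then show "finite J" "J \<subseteq> I" by (auto simp: J_def)
    fix x i assume x: "x \<in> carrier (free_module R n)" and i: "i \<in> I - J"
    then have iI: "i \<in> I" by simp
    have "((\<lambda>y. y i) \<circ> h) x = (\<lambda>_. \<zero>\<^bsub>F i\<^esub>) x"
    proof (rule free_module_hom_eq[OF assms(1) assms(2)[OF iI] _ _ _ x])
      interpret Fi: left_module R "F i" by (rule assms(2)[OF iI])
      show "(\<lambda>y. y i) \<circ> h \<in> mod_hom R (free_module R n) (F i)"
        by (rule mod_hom_compose[OF assms(3) f.ds_proj_hom[OF iI]])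
      show "(\<lambda>_. \<zero>\<^bsub>F i\<^esub>) \<in> mod_hom R (free_module R n) (F i)"
        by (rule mod_homI) simp_all
      show "((\<lambda>y. y i) \<circ> h) (unit_vec R n j) = \<zero>\<^bsub>F i\<^esub>" if "j < n" for j
        using that i by (auto simp: J_def)
    qed
    then show "h x i = \<zero>\<^bsub>F i\<^esub>" by simp
  qed
qed

text \<open>The structure is carried over along the bijection of \<open>P\<close> with its image.
  This moves modules built over other types into the universe in which purity is compared.\<close>

lemma module_transport:
  fixes P :: "('a, 'v, 'm) module_scheme" and e :: "'v \<Rightarrow> 'u"
  assumes "left_module R P" "inj_on e (carrier P)"
  obtains P' :: "('a, 'u) module"
  where "left_module R P'" "e \<in> mod_hom R P P'" "bij_betw e (carrier P) (carrier P')"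
proof -
  interpret P: left_module R P by fact
  define d where "d = inv_into (carrier P) e"
  have d [simp]: "d (e x) = x" if "x \<in> carrier P" for x
    using that assms(2) by (simp add: d_def)
  define P' :: "('a, 'u) module" where
    "P' = \<lparr>carrier = e ` carrier P, monoid.mult = undefined, one = undefined, ring.zero = e \<zero>\<^bsub>P\<^esub>,
       ring.add = (\<lambda>x y. e (d x \<oplus>\<^bsub>P\<^esub> d y)), smult = (\<lambda>a x. e (a \<odot>\<^bsub>P\<^esub> d x))\<rparr>"
  have "\<exists>y\<in>carrier P. e (y \<oplus>\<^bsub>P\<^esub> x) = e \<zero>\<^bsub>P\<^esub>" if "x \<in> carrier P" for x
    using that by (intro bexI[of _ "\<ominus>\<^bsub>P\<^esub> x"]) (simp_all add: P.M.l_neg)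
  then have "abelian_group P'"
    by (intro abelian_groupI) (auto simp: P'_def P.M.a_ac)
  then have "left_module R P'"
    unfolding left_module_def left_module_axioms_def
    using P.R.ring_axioms
    by (auto simp: P'_def P.smult_l_distr P.smult_r_distr P.smult_assoc1)
  moreover have "e \<in> mod_hom R P P'"
    by (rule mod_homI) (auto simp: P'_def)
  moreover have "bij_betw e (carrier P) (carrier P')"
    using assms(2) by (simp add: P'_def bij_betw_def)
  ultimately show ?thesis using that by blast
qed

text \<open>Two preimages of the same element under \<open>g\<close> differ by an element of its
  kernel, where \<open>h\<close> vanishes. Hence any choice of preimages defines the same map, and
  it is linear.\<close>

lemma mod_hom_factor:
  assumes L: "left_module R L" and A: "left_module R A" and B: "left_module R B"
    and g: "g \<in> mod_hom R L A" "g ` carrier L = carrier A"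
    and h: "h \<in> mod_hom R L B"
    and ker: "\<And>x. x \<in> carrier L \<Longrightarrow> g x = \<zero>\<^bsub>A\<^esub> \<Longrightarrow> h x = \<zero>\<^bsub>B\<^esub>"
  obtains k where "k \<in> mod_hom R A B" "\<And>x. x \<in> carrier L \<Longrightarrow> k (g x) = h x"
proof -
  interpret L: left_module R L by fact
  interpret A: left_module R A by fact
  interpret B: left_module R B by fact
  note cl = mod_hom_closed[OF g(1)] mod_hom_closed[OF h]
  have eq: "h x = h y" if "x \<in> carrier L" "y \<in> carrier L" "g x = g y" for x y
  proof -
    have "g (x \<oplus>\<^bsub>L\<^esub> \<ominus>\<^bsub>L\<^esub> y) = \<zero>\<^bsub>A\<^esub>"
      using that cl by (simp add: mod_hom_add[OF g(1)] mod_hom_a_inv[OF L A g(1)] A.M.r_neg)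
    then have "h (x \<oplus>\<^bsub>L\<^esub> \<ominus>\<^bsub>L\<^esub> y) = \<zero>\<^bsub>B\<^esub>"
      using that by (intro ker) simp_all
    then have "h x \<oplus>\<^bsub>B\<^esub> \<ominus>\<^bsub>B\<^esub> h y = \<zero>\<^bsub>B\<^esub>"
      using that by (simp add: mod_hom_add[OF h] mod_hom_a_inv[OF L B h])
    then show ?thesis
      using that cl B.M.minus_equality[of "h x" "\<ominus>\<^bsub>B\<^esub> h y"] by simp
  qed
  define k where "k y = h (inv_into (carrier L) g y)" for y
  have k: "k (g x) = h x" if "x \<in> carrier L" for x
    unfolding k_def using that
    by (intro eq) (auto intro: inv_into_into f_inv_into_f)
  have sur: "\<exists>u\<in>carrier L. x = g u" if "x \<in> carrier A" for x
    using that g(2) by auto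
  have "k \<in> mod_hom R A B"
  proof (rule mod_homI)
    show "k x \<in> carrier B" if "x \<in> carrier A" for x
      using sur[OF that] k cl by auto
    show "k (x \<oplus>\<^bsub>A\<^esub> y) = k x \<oplus>\<^bsub>B\<^esub> k y" if xy: "x \<in> carrier A" "y \<in> carrier A" for x y
    proof -
      obtain u v where "u \<in> carrier L" "x = g u" "v \<in> carrier L" "y = g v"
        using sur xy by blast
      then show ?thesis
        using k[of "u \<oplus>\<^bsub>L\<^esub> v"] k by (simp add: mod_hom_add[OF g(1)] mod_hom_add[OF h])
    qed
    show "k (a \<odot>\<^bsub>A\<^esub> x) = a \<odot>\<^bsub>B\<^esub> k x" if ax: "a \<in> carrier R" "x \<in> carrier A" for a x
    proof -
      obtain u where "u \<in> carrier L" "x = g u"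
        using sur ax by blast
      then show ?thesis
        using ax k[of "a \<odot>\<^bsub>L\<^esub> u"] k by (simp add: mod_hom_smult[OF g(1)] mod_hom_smult[OF h])
    qed
  qed
  with k that show ?thesis by blast
qed


section \<open>Purity as a lifting property\<close>

text \<open>Surjectivity of the map that \<open>g\<close> induces on homomorphisms out of
  \<open>M\<close>. The functions need not be extensional and have to agree only on the carrier, so
  that ordinary composition suffices in the arguments.\<close>

definition lifts ::
  "('a, 'r) ring_scheme \<Rightarrow> ('a, 'u, 'm) module_scheme \<Rightarrow> ('a, 'v, 'n) module_scheme \<Rightarrow>
    ('a, 'w, 'k) module_scheme \<Rightarrow> ('v \<Rightarrow> 'w) \<Rightarrow> bool"
where
  "lifts R M B C g \<longleftrightarrow>
     (\<forall>h \<in> mod_hom R M C. \<exists>k \<in> mod_hom R M B. \<forall>x \<in> carrier M. g (k x) = h x)"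

lemma left_module_group: "left_module R M \<Longrightarrow> group (add_monoid M)"
  by (simp only: left_module_def abelian_group.a_group)

lemma liftsE:
  assumes "lifts R M B C g" "h \<in> mod_hom R M C"
  obtains k where "k \<in> mod_hom R M B" "\<And>x. x \<in> carrier M \<Longrightarrow> g (k x) = h x"
  using assms unfolding lifts_def by blast

lemma carrier_Hom_group:
  "h \<in> carrier (Hom_group R M N) \<longleftrightarrow> h \<in> mod_hom R M N \<and> h \<in> extensional (carrier M)"
  by (simp add: Hom_group_def)

lemma Hom_group_closed:
  assumes "h \<in> carrier (Hom_group R M N)" "x \<in> carrier M"
  shows "h x \<in> carrier N"
  using assms mod_hom_closed[of h R M N x] by (simp add: carrier_Hom_group)

lemma mult_Hom_group:
  "h \<otimes>\<^bsub>Hom_group R M N\<^esub> k = (\<lambda>x\<in>carrier M. h x \<oplus>\<^bsub>N\<^esub> k x)"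
  by (simp add: Hom_group_def)

lemma one_Hom_group: "\<one>\<^bsub>Hom_group R M N\<^esub> = (\<lambda>x\<in>carrier M. \<zero>\<^bsub>N\<^esub>)"
  by (simp add: Hom_group_def)

lemma restrict_mod_hom:
  assumes "left_module R M"
  shows "restrict h (carrier M) \<in> mod_hom R M N \<longleftrightarrow> h \<in> mod_hom R M N"
  by (rule mod_hom_cong[OF assms]) simp

lemma group_Hom_group:
  assumes "left_module R M" "left_module R N"
  shows "group (Hom_group R M N)"
proof -
  interpret M: left_module R M by fact
  interpret N: left_module R N by fact
  show ?thesis
  proof (rule groupI)
    fix h k assume h: "h \<in> carrier (Hom_group R M N)" and k: "k \<in> carrier (Hom_group R M N)"
    have hk: "h \<in> mod_hom R M N" "k \<in> mod_hom R M N"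
      using h k by (simp_all add: carrier_Hom_group)
    have "(\<lambda>x. h x \<oplus>\<^bsub>N\<^esub> k x) \<in> mod_hom R M N"
      using hk[THEN mod_hom_closed]
      by (intro mod_homI)
        (simp_all add: hk[THEN mod_hom_add] hk[THEN mod_hom_smult] N.smult_r_distr N.M.a_ac)
    then show "h \<otimes>\<^bsub>Hom_group R M N\<^esub> k \<in> carrier (Hom_group R M N)"
      by (simp add: mult_Hom_group carrier_Hom_group restrict_mod_hom[OF assms(1)])
  next
    have "(\<lambda>x. \<zero>\<^bsub>N\<^esub>) \<in> mod_hom R M N"
      by (intro mod_homI) simp_all
    then show "\<one>\<^bsub>Hom_group R M N\<^esub> \<in> carrier (Hom_group R M N)"
      by (simp add: one_Hom_group carrier_Hom_group restrict_mod_hom[OF assms(1)])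
  next
    fix h k l
    assume *: "h \<in> carrier (Hom_group R M N)" "k \<in> carrier (Hom_group R M N)"
      "l \<in> carrier (Hom_group R M N)"
    have hkl: "h \<in> mod_hom R M N" "k \<in> mod_hom R M N" "l \<in> mod_hom R M N"
      using * by (simp_all add: carrier_Hom_group)
    show "h \<otimes>\<^bsub>Hom_group R M N\<^esub> k \<otimes>\<^bsub>Hom_group R M N\<^esub> l =
        h \<otimes>\<^bsub>Hom_group R M N\<^esub> (k \<otimes>\<^bsub>Hom_group R M N\<^esub> l)"
      unfolding mult_Hom_group using hkl[THEN mod_hom_closed]
      by (intro restrict_ext) (simp add: N.M.a_assoc)
  next
    fix h assume *: "h \<in> carrier (Hom_group R M N)"
    have h: "h \<in> mod_hom R M N" "h \<in> extensional (carrier M)"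
      using * by (simp_all add: carrier_Hom_group)
    show "\<one>\<^bsub>Hom_group R M N\<^esub> \<otimes>\<^bsub>Hom_group R M N\<^esub> h = h"
      unfolding mult_Hom_group one_Hom_group using h mod_hom_closed[OF h(1)]
      by (intro extensionalityI[of _ "carrier M"]) simp_all
    show "\<exists>k\<in>carrier (Hom_group R M N). k \<otimes>\<^bsub>Hom_group R M N\<^esub> h = \<one>\<^bsub>Hom_group R M N\<^esub>"
    proof
      have "(\<lambda>x. \<ominus>\<^bsub>N\<^esub> h x) \<in> mod_hom R M N"
        using mod_hom_closed[OF h(1)]
        by (intro mod_homI)
          (simp_all add: mod_hom_add[OF h(1)] mod_hom_smult[OF h(1)] N.smult_a_inv N.M.minus_add)
      then show "(\<lambda>x\<in>carrier M. \<ominus>\<^bsub>N\<^esub> h x) \<in> carrier (Hom_group R M N)"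
        by (simp add: carrier_Hom_group restrict_mod_hom[OF assms(1)])
      show "(\<lambda>x\<in>carrier M. \<ominus>\<^bsub>N\<^esub> h x) \<otimes>\<^bsub>Hom_group R M N\<^esub> h = \<one>\<^bsub>Hom_group R M N\<^esub>"
        unfolding mult_Hom_group one_Hom_group using mod_hom_closed[OF h(1)]
        by (intro restrict_ext) (simp add: N.M.l_neg)
    qed
  qed
qed

lemma compose_Hom_group_hom:
  assumes M: "left_module R M" and f: "f \<in> mod_hom R A B"
  shows "compose (carrier M) f \<in> hom (Hom_group R M A) (Hom_group R M B)"
proof (rule homI)
  interpret M: left_module R M by fact
  fix h assume h: "h \<in> carrier (Hom_group R M A)"
  then show "compose (carrier M) f h \<in> carrier (Hom_group R M B)"
    using mod_hom_compose[of h R M A f B] f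
    by (simp add: carrier_Hom_group compose_def restrict_mod_hom[OF M] comp_def)
  fix k assume k: "k \<in> carrier (Hom_group R M A)"
  show "compose (carrier M) f (h \<otimes>\<^bsub>Hom_group R M A\<^esub> k) =
      compose (carrier M) f h \<otimes>\<^bsub>Hom_group R M B\<^esub> compose (carrier M) f k"
    unfolding mult_Hom_group compose_def using h k mod_hom_closed[of h R M A] mod_hom_closed[of k R M A]
    by (intro restrict_ext) (simp add: carrier_Hom_group mod_hom_add[OF f])
qed

text \<open>Homomorphisms out of \<open>M\<close> form a left exact functor, so injectivity and
  exactness in the middle hold for every \<open>M\<close>. What remains is surjectivity, and that is
  \<open>lifts\<close>.\<close>

lemma short_exact_Hom_iff_lifts:
  assumes se: "mod_short_exact R A B C f g" and M: "left_module R M"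
  shows "short_exact (Hom_group R M A) (Hom_group R M B) (Hom_group R M C)
      (compose (carrier M) f) (compose (carrier M) g) \<longleftrightarrow> lifts R M B C g"
proof -
  interpret M: left_module R M by fact
  have A: "left_module R A" and B: "left_module R B" and C: "left_module R C"
    and f: "f \<in> mod_hom R A B" and g: "g \<in> mod_hom R B C" and inj: "inj_on f (carrier A)"
    and im: "f ` carrier A = {x \<in> carrier B. g x = \<zero>\<^bsub>C\<^esub>}"
    using se by (auto simp: mod_short_exact_def short_exact_def mon_def kernel_def)
  note hf = compose_Hom_group_hom[OF M f] and hg = compose_Hom_group_hom[OF M g]
  have gf: "g (f x) = \<zero>\<^bsub>C\<^esub>" if "x \<in> carrier A" for x
    using im that by blast
  have "inj_on (compose (carrier M) f) (carrier (Hom_group R M A))"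
  proof (rule inj_onI)
    fix h k assume h: "h \<in> carrier (Hom_group R M A)" and k: "k \<in> carrier (Hom_group R M A)"
      and eq: "compose (carrier M) f h = compose (carrier M) f k"
    show "h = k"
    proof (rule extensionalityI[of _ "carrier M"])
      show "h x = k x" if "x \<in> carrier M" for x
      proof (rule inj_onD[OF inj])
        show "f (h x) = f (k x)"
          using fun_cong[OF eq, of x] that by (simp add: compose_def)
      qed (rule Hom_group_closed[OF h that] Hom_group_closed[OF k that])+
    qed (use h k in \<open>simp_all add: carrier_Hom_group\<close>)
  qed
  then have mon: "compose (carrier M) f \<in> mon (Hom_group R M A) (Hom_group R M B)"
    using hf by (simp add: mon_def)
  have ker: "compose (carrier M) f ` carrier (Hom_group R M A) =
      kernel (Hom_group R M B) (Hom_group R M C) (compose (carrier M) g)"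
  proof (intro equalityI subsetI)
    fix k assume "k \<in> compose (carrier M) f ` carrier (Hom_group R M A)"
    then obtain h where h: "h \<in> carrier (Hom_group R M A)" "k = compose (carrier M) f h"
      by blast
    have "compose (carrier M) g k = \<one>\<^bsub>Hom_group R M C\<^esub>"
      unfolding h(2) one_Hom_group compose_def using Hom_group_closed[OF h(1)]
      by (intro restrict_ext) (simp add: gf)
    then show "k \<in> kernel (Hom_group R M B) (Hom_group R M C) (compose (carrier M) g)"
      using h hom_in_carrier[OF hf] by (simp add: kernel_def)
  next
    fix k assume k: "k \<in> kernel (Hom_group R M B) (Hom_group R M C) (compose (carrier M) g)"
    then have kh: "k \<in> mod_hom R M B" "k \<in> extensional (carrier M)"
      and k0: "compose (carrier M) g k = (\<lambda>x\<in>carrier M. \<zero>\<^bsub>C\<^esub>)"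
      by (simp_all add: kernel_def carrier_Hom_group one_Hom_group)
    have kf: "k x \<in> f ` carrier A" if "x \<in> carrier M" for x
      using fun_cong[OF k0, of x] that mod_hom_closed[OF kh(1) that] im by (simp add: compose_def)
    \<comment> \<open>\<open>k\<close> takes values in the image of \<open>f\<close>. With the
      codomain cut down to this image, \<open>f\<close> becomes an isomorphism, and its inverse
      composed with \<open>k\<close> is the required preimage.\<close>
    let ?B = "B\<lparr>carrier := f ` carrier A\<rparr>"
    have "k \<in> mod_hom R M ?B"
      using kh(1) kf by (simp add: mod_hom_def hom_def)
    moreover have "f \<in> mod_hom R A ?B" "bij_betw f (carrier A) (carrier ?B)"
      using f inj by (simp_all add: mod_hom_def hom_def bij_betw_def)
    ultimately have "inv_into (carrier A) f \<circ> k \<in> mod_hom R M A"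
      using mod_hom_compose mod_hom_inv_into[OF A] by blast
    then have "restrict (inv_into (carrier A) f \<circ> k) (carrier M) \<in> carrier (Hom_group R M A)"
      by (simp only: carrier_Hom_group restrict_mod_hom[OF M] restrict_extensional simp_thms)
    moreover have "k = compose (carrier M) f (restrict (inv_into (carrier A) f \<circ> k) (carrier M))"
      using kf kh(2)
      by (intro extensionalityI[of _ "carrier M"]) (simp_all add: compose_def f_inv_into_f)
    ultimately show "k \<in> compose (carrier M) f ` carrier (Hom_group R M A)"
      by blast
  qed
  have "compose (carrier M) g \<in> epi (Hom_group R M B) (Hom_group R M C) \<longleftrightarrow> lifts R M B C g"
  proof
    assume "compose (carrier M) g \<in> epi (Hom_group R M B) (Hom_group R M C)"
    then have sur: "compose (carrier M) g ` carrier (Hom_group R M B) = carrier (Hom_group R M C)"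
      by (simp add: epi_def)
    show "lifts R M B C g"
      unfolding lifts_def
    proof
      fix h assume "h \<in> mod_hom R M C"
      then have "restrict h (carrier M) \<in> carrier (Hom_group R M C)"
        by (simp add: carrier_Hom_group restrict_mod_hom[OF M])
      then obtain k where k: "k \<in> carrier (Hom_group R M B)"
        "restrict h (carrier M) = compose (carrier M) g k"
        unfolding sur[symmetric] by blast
      have "g (k x) = h x" if "x \<in> carrier M" for x
        using fun_cong[OF k(2), of x] that by (simp add: compose_def)
      with k(1) show "\<exists>k\<in>mod_hom R M B. \<forall>x\<in>carrier M. g (k x) = h x"
        by (auto simp: carrier_Hom_group)
    qed
  next
    assume l: "lifts R M B C g"
    have "h \<in> compose (carrier M) g ` carrier (Hom_group R M B)"
      if "h \<in> carrier (Hom_group R M C)" for h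
    proof -
      have h: "h \<in> mod_hom R M C" "h \<in> extensional (carrier M)"
        using that by (simp_all add: carrier_Hom_group)
      obtain k where k: "k \<in> mod_hom R M B" "\<And>x. x \<in> carrier M \<Longrightarrow> g (k x) = h x"
        using l h(1) by (rule liftsE) blast
      have "restrict k (carrier M) \<in> carrier (Hom_group R M B)"
        using k(1) by (simp add: carrier_Hom_group restrict_mod_hom[OF M])
      moreover have "h = compose (carrier M) g (restrict k (carrier M))"
        using h(2) k(2) by (intro extensionalityI[of _ "carrier M"]) (simp_all add: compose_def)
      ultimately show ?thesis by blast
    qed
    then have "compose (carrier M) g ` carrier (Hom_group R M B) = carrier (Hom_group R M C)"
      using hom_in_carrier[OF hg] by blast
    then show "compose (carrier M) g \<in> epi (Hom_group R M B) (Hom_group R M C)"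
      using hg by (simp add: epi_def)
  qed
  then show ?thesis
    by (simp only: short_exact_def mon ker group_Hom_group[OF M A] group_Hom_group[OF M B]
        group_Hom_group[OF M C] simp_thms)
qed

lemma pure_iff_lifts:
  assumes "mod_short_exact R A B C f g" "\<And>M. M \<in> Xs \<Longrightarrow> left_module R M"
  shows "pure R Xs A B C f g \<longleftrightarrow> (\<forall>M\<in>Xs. lifts R M B C g)"
  unfolding pure_def using short_exact_Hom_iff_lifts[OF assms(1) assms(2)] by blast

text \<open>The inclusion of the kernel is written as the identity function. The comparison of
  purities is later applied to a sequence of this form.\<close>

lemma mod_short_exact_kernel:
  assumes P: "left_module R P" and M: "left_module R M" and q: "q \<in> mod_hom R P M"
    and sur: "q ` carrier P = carrier M"
  shows "mod_short_exact R (P\<lparr>carrier := {x \<in> carrier P. q x = \<zero>\<^bsub>M\<^esub>}\<rparr>) P M (\<lambda>x. x) q"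
proof -
  let ?K = "P\<lparr>carrier := {x \<in> carrier P. q x = \<zero>\<^bsub>M\<^esub>}\<rparr>"
  have K: "left_module R ?K"
    by (rule left_module_submodule[OF P submodule_kernel[OF P M q]])
have "(\<lambda>x. x) \<in> mod_hom R ?K P"
    by (rule mod_homI) simp_all
  moreover have "group (add_monoid ?K)" "group (add_monoid P)" "group (add_monoid M)"
    by (rule K P M left_module_group)+
  ultimately show ?thesis
    using K P M q sur
    by (auto simp: mod_short_exact_def short_exact_def mon_def epi_def kernel_def mod_hom_def)
qed

text \<open>With a section \<open>s\<close> and a retraction \<open>p\<close>, a lift of
  \<open>h\<close> after \<open>p\<close>, precomposed with \<open>s\<close>, is a lift of
  \<open>h\<close>.\<close>

lemma lifts_direct_summand:
  assumes "direct_summand R M N" "lifts R N B C g"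
  shows "lifts R M B C g"
  unfolding lifts_def
proof
  fix h assume h: "h \<in> mod_hom R M C"
  obtain s p where sp: "s \<in> mod_hom R M N" "p \<in> mod_hom R N M"
    "\<And>x. x \<in> carrier M \<Longrightarrow> p (s x) = x"
    using assms(1) by (rule direct_summandE) blast
  obtain k where k: "k \<in> mod_hom R N B" "\<And>x. x \<in> carrier N \<Longrightarrow> g (k x) = (h \<circ> p) x"
    using assms(2) mod_hom_compose[OF sp(2) h] by (rule liftsE) blast
  show "\<exists>k\<in>mod_hom R M B. \<forall>x\<in>carrier M. g (k x) = h x"
    using mod_hom_compose[OF sp(1) k(1)] k(2) sp(3) mod_hom_closed[OF sp(1)]
    by (intro bexI[of _ "k \<circ> s"]) simp_all
qed

text \<open>The restriction of \<open>h\<close> to each summand is lifted separately, and the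
  universal property combines the chosen lifts. The result lifts \<open>h\<close> because it does so
  on every summand.\<close>

lemma lifts_direct_sum:
  assumes R: "ring R" and F: "\<And>i. i \<in> I \<Longrightarrow> left_module R (F i)" and B: "left_module R B" and C: "left_module R C"
    and g: "g \<in> mod_hom R B C" and l: "\<And>i. i \<in> I \<Longrightarrow> lifts R (F i) B C g"
  shows "lifts R (direct_sum I F) B C g"
  unfolding lifts_def
proof
  interpret module_family R I F by (rule module_family.intro[OF R F])
  fix h assume h: "h \<in> mod_hom R D C"
  have "\<exists>k. k \<in> mod_hom R (F i) B \<and> (\<forall>x\<in>carrier (F i). g (k x) = (h \<circ> ds_inj I F i) x)"
    if "i \<in> I" for i
    using l[OF that] mod_hom_compose[OF ds_inj_hom[OF that] h] unfolding lifts_def by blast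
  then obtain k where k: "\<And>i. i \<in> I \<Longrightarrow> k i \<in> mod_hom R (F i) B"
    "\<And>i x. i \<in> I \<Longrightarrow> x \<in> carrier (F i) \<Longrightarrow> g (k i x) = h (ds_inj I F i x)"
    by (metis comp_apply)
  have kl: "ds_lift B k \<in> mod_hom R D B"
    by (rule ds_lift_hom[OF B k(1)])
  have "(g \<circ> ds_lift B k) x = h x" if "x \<in> carrier D" for x
    by (rule ds_hom_eq[OF C mod_hom_compose[OF kl g] h _ that])
      (simp add: k ds_lift_inj[OF B k(1)])
  then show "\<exists>k\<in>mod_hom R D B. \<forall>x\<in>carrier D. g (k x) = h x"
    using kl by (intro bexI[of _ "ds_lift B k"]) simp_all
qed

text \<open>The regular module is projective: if \<open>b\<close> is a preimage under
  \<open>g\<close> of the value of \<open>h\<close> at one, then \<open>r |-> r b\<close> lifts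
  \<open>h\<close>.\<close>

lemma lifts_regular_module:
  assumes R: "ring R" and B: "left_module R B" and g: "g \<in> mod_hom R B C"
    and sur: "g ` carrier B = carrier C"
  shows "lifts R (regular_module R) B C g"
  unfolding lifts_def
proof
  interpret B: left_module R B by fact
  fix h assume h: "h \<in> mod_hom R (regular_module R) C"
  have "h \<one>\<^bsub>R\<^esub> \<in> g ` carrier B"
    using mod_hom_closed[OF h, of "\<one>\<^bsub>R\<^esub>"] sur by simp
  then obtain b where b: "b \<in> carrier B" "h \<one>\<^bsub>R\<^esub> = g b" by blast
  have "(\<lambda>r. r \<odot>\<^bsub>B\<^esub> b) \<in> mod_hom R (regular_module R) B"
    using b by (intro mod_homI) (simp_all add: B.smult_l_distr B.smult_assoc1)
  moreover have "g (r \<odot>\<^bsub>B\<^esub> b) = h r" if "r \<in> carrier R" for r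
    using mod_hom_smult[OF h, of r "\<one>\<^bsub>R\<^esub>"] mod_hom_smult[OF g, of r b] b that by simp
  ultimately show "\<exists>k\<in>mod_hom R (regular_module R) B. \<forall>x\<in>carrier (regular_module R). g (k x) = h x"
    by (intro bexI[of _ "\<lambda>r. r \<odot>\<^bsub>B\<^esub> b"]) simp_all
qed

section \<open>Isomorphic copies, transitivity and finite subsums\<close>

lemma mod_isomorphic_sym:
  assumes "mod_isomorphic R M N"
  shows "mod_isomorphic R N M"
proof -
  obtain h where *: "left_module R M" "left_module R N" "h \<in> mod_hom R M N"
    "bij_betw h (carrier M) (carrier N)"
    using assms unfolding mod_isomorphic_def by blast
  then show ?thesis
    using mod_hom_inv_into[OF *(1,3,4)] bij_betw_inv_into[OF *(4)] unfolding mod_isomorphic_def by blast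
qed

lemma direct_summand_mod_isomorphic:
  assumes "mod_isomorphic R M N"
  shows "direct_summand R M N"
proof -
  obtain h where *: "left_module R M" "left_module R N" "h \<in> mod_hom R M N"
    "bij_betw h (carrier M) (carrier N)"
    using assms unfolding mod_isomorphic_def by blast
  show ?thesis
    by (rule direct_summandI[OF *(1-3) mod_hom_inv_into[OF *(1,3,4)]])
      (use *(4) in \<open>simp add: bij_betw_def\<close>)
qed

lemma direct_summand_trans:
  assumes "direct_summand R L M" "direct_summand R M N"
  shows "direct_summand R L N"
proof -
  obtain s p where 1: "left_module R L" "s \<in> mod_hom R L M" "p \<in> mod_hom R M L"
    "\<And>x. x \<in> carrier L \<Longrightarrow> p (s x) = x"
    using assms(1) by (rule direct_summandE) blast
  obtain t q where 2: "left_module R N" "t \<in> mod_hom R M N" "q \<in> mod_hom R N M"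
    "\<And>x. x \<in> carrier M \<Longrightarrow> q (t x) = x"
    using assms(2) by (rule direct_summandE) blast
  show ?thesis
    using 1(4) 2(4) mod_hom_closed[OF 1(2)]
    by (intro direct_summandI[OF 1(1) 2(1) mod_hom_compose[OF 1(2) 2(2)] mod_hom_compose[OF 2(3) 1(3)]])
      simp
qed

lemma direct_summand_direct_sum:
  assumes "ring R" "\<And>i. i \<in> I \<Longrightarrow> left_module R (F i)" "i \<in> I"
  shows "direct_summand R (F i) (direct_sum I F)"
proof -
  interpret module_family R I F by (rule module_family.intro[OF assms(1,2)])
  show ?thesis
    by (rule direct_summandI[OF assms(2)[OF assms(3)] D.left_module_axioms
          ds_inj_hom[OF assms(3)] ds_proj_hom[OF assms(3)]])
      (simp add: ds_inj_apply assms(3))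
qed

text \<open>The section \<open>s\<close> ends in the subsum over the finite set \<open>J\<close>, so
  passing to the coordinates in \<open>J\<close> and back does not change it, and \<open>p\<close>
  still yields a retraction. \<open>J\<close> is enumerated by \<open>e\<close> because
  \<open>add_class\<close> uses the index sets \<open>{..<n}\<close>.\<close>

lemma direct_summand_finite_subsum:
  assumes R: "ring R" and F: "\<And>i. i \<in> I \<Longrightarrow> left_module R (F i)" and M: "left_module R M"
    and s: "s \<in> mod_hom R M (direct_sum I F)" and p: "p \<in> mod_hom R (direct_sum I F) M"
    and ps: "\<And>x. x \<in> carrier M \<Longrightarrow> p (s x) = x"
    and J: "finite J" "J \<subseteq> I" "\<And>x i. x \<in> carrier M \<Longrightarrow> i \<in> I - J \<Longrightarrow> s x i = \<zero>\<^bsub>F i\<^esub>"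
  obtains n :: nat and e where "e ` {..<n} \<subseteq> I" "direct_summand R M (direct_sum {..<n} (\<lambda>j. F (e j)))"
proof -
  interpret module_family R I F by (rule module_family.intro[OF R F])
  obtain n :: nat and e where "J = e ` {i. i < n}" and inj: "inj_on e {i. i < n}"
    using finite_imp_nat_seg_image_inj_on[OF J(1)] by blast
  then have e: "J = e ` {..<n}" "inj_on e {..<n}" by (simp_all add: lessThan_def)
  have eI: "e j \<in> I" if "j < n" for j
    using e(1) J(2) that by blast
  interpret E: module_family R "{..<n}" "\<lambda>j. F (e j)"
    by (rule module_family.intro[OF R]) (simp add: F eI)
  have ie: "inv_into {..<n} e (e j) = j" if "j < n" for j
    using e(2) that by simp
  \<comment> \<open>\<open>?r\<close> keeps the coordinates in \<open>J\<close>, renumbered along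
    \<open>e\<close>; \<open>?q\<close> below puts them back in place.\<close>
  let ?r = "\<lambda>x. \<lambda>j\<in>{..<n}. x (e j)"
  have mem: "x i \<in> carrier (F i)" if "x \<in> carrier D" "i \<in> I" for x i
    using that by (simp add: carrier PiE_iff)
  have r: "?r \<in> mod_hom R D E.D"
  proof (rule mod_homI)
    show "?r x \<in> carrier E.D" if "x \<in> carrier D" for x
    proof -
      have "?r x \<in> (\<Pi>\<^sub>E j\<in>{..<n}. carrier (F (e j)))"
        using mem[OF that] eI by simp
      then show ?thesis unfolding E.carrier by (intro CollectI conjI) simp_all
    qed
  qed (simp_all add: eI direct_sum_ops cong: restrict_cong)
  let ?q = "E.ds_lift D (\<lambda>j. ds_inj I F (e j))"
  have q: "?q \<in> mod_hom R E.D D"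
    by (rule E.ds_lift_hom[OF D.left_module_axioms ds_inj_hom]) (simp add: eI)
  have q_apply: "?q z i = (if i \<in> J then z (inv_into {..<n} e i) else \<zero>\<^bsub>F i\<^esub>)"
    if z: "z \<in> carrier E.D" and i: "i \<in> I" for z i
  proof -
    \<comment> \<open>\<open>?t\<close> is the expected \<open>i\<close>-th coordinate of
      \<open>?q\<close>. As both are homomorphisms, it is enough to compare them on the single
      summands.\<close>
    let ?t = "\<lambda>z. if i \<in> J then z (inv_into {..<n} e i) else \<zero>\<^bsub>F i\<^esub>"
    interpret Fi: left_module R "F i" by (rule F[OF i])
    have t: "?t \<in> mod_hom R E.D (F i)"
    proof (cases "i \<in> J")
      case True
      then obtain j where j: "j < n" "i = e j" using e(1) by blast
      then show ?thesis using E.ds_proj_hom[of j] True by (simp add: ie)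
    next
      case False
      then show ?thesis by (intro mod_homI) simp_all
    qed
    have "((\<lambda>x. x i) \<circ> ?q) z = ?t z"
    proof (rule E.ds_hom_eq[OF Fi.left_module_axioms mod_hom_compose[OF q ds_proj_hom[OF i]] t _ z])
      fix j u assume j: "j \<in> {..<n}" and u: "u \<in> carrier (F (e j))"
      have "?q (ds_inj {..<n} (\<lambda>j. F (e j)) j u) = ds_inj I F (e j) u"
        by (rule E.ds_lift_inj[OF D.left_module_axioms ds_inj_hom j u]) (simp add: eI)
      moreover have "inv_into {..<n} e i \<in> {..<n} \<and> e (inv_into {..<n} e i) = i" if "i \<in> J"
        using that e(1) inv_into_into f_inv_into_f by metis
      ultimately show "((\<lambda>x. x i) \<circ> ?q) (ds_inj {..<n} (\<lambda>j. F (e j)) j u) =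
          ?t (ds_inj {..<n} (\<lambda>j. F (e j)) j u)"
        using i j ie e(1) by (auto simp: ds_inj_apply)
    qed
    then show ?thesis by simp
  qed
  have "?q (?r (s x)) = s x" if x: "x \<in> carrier M" for x
  proof (rule extensionalityI[of _ I])
    have sx: "s x \<in> carrier D" by (rule mod_hom_closed[OF s x])
    have rx: "?r (s x) \<in> carrier E.D" by (rule mod_hom_closed[OF r sx])
    show "?q (?r (s x)) \<in> extensional I" "s x \<in> extensional I"
      using sx mod_hom_closed[OF q rx] by (simp_all add: carrier PiE_iff)
    show "?q (?r (s x)) i = s x i" if "i \<in> I" for i
    proof (cases "i \<in> J")
      case True
      then obtain j where "j < n" "i = e j" using e(1) by blast
      then show ?thesis using q_apply[OF rx that] True by (simp add: ie)
    next
      case False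
      then show ?thesis using q_apply[OF rx that] J(3)[OF x] that by simp
    qed
  qed
  then have "direct_summand R M E.D"
    using ps
    by (intro direct_summandI[OF M E.D.left_module_axioms mod_hom_compose[OF s r] mod_hom_compose[OF q p]])
      simp
  then show ?thesis
    using that[of e n] eI by blast
qed


section \<open>Finitely presented modules\<close>

lemma finitely_presentedE:
  assumes "finitely_presented R M"
  obtains m n f g where "f \<in> mod_hom R (free_module R m) (free_module R n)"
    "g \<in> mod_hom R (free_module R n) M" "g ` carrier (free_module R n) = carrier M"
    "f ` carrier (free_module R m) = {x \<in> carrier (free_module R n). g x = \<zero>\<^bsub>M\<^esub>}"
  using assms unfolding finitely_presented_def Let_def a_kernel_def kernel_def by auto

lemma finitely_presented_left_module: "finitely_presented R M \<Longrightarrow> left_module R M"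
  by (simp add: finitely_presented_def)

text \<open>One generator and no relations: in \<open>R^0 -> R^1 -> M\<close> the second map reads
  the only coordinate and applies the isomorphism \<open>h\<close>, so its kernel is zero.\<close>

lemma regular_class_finitely_presented:
  assumes R: "ring R" and M: "M \<in> regular_class R"
  shows "finitely_presented R M"
proof -
  interpret R: ring R by fact
  obtain h where LM: "left_module R M" and h: "h \<in> mod_hom R (regular_module R) M"
    and bij: "bij_betw h (carrier R) (carrier M)"
    using mod_isomorphic_sym[of R M "regular_module R"] M
    unfolding regular_class_def mod_isomorphic_def by auto
  interpret M: left_module R M by fact
  interpret r0: module_family R "{..<0::nat}" "\<lambda>_. regular_module R"
    using R by (rule module_family_regular)
  interpret r1: module_family R "{..<Suc 0}" "\<lambda>_. regular_module R"
    using R by (rule module_family_regular)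
  let ?f = "\<lambda>_::nat \<Rightarrow> 'a. \<zero>\<^bsub>r1.D\<^esub>" and ?g = "h \<circ> (\<lambda>x. x (0::nat))"
  have f: "?f \<in> mod_hom R r0.D r1.D"
    by (rule mod_homI) (simp_all only: r1.D.M.zero_closed r1.D.M.l_zero r1.D.smult_r_null)
  have g: "?g \<in> mod_hom R r1.D M"
    by (rule mod_hom_compose[OF r1.ds_proj_hom h]) simp
  have h0: "h \<zero>\<^bsub>R\<^esub> = \<zero>\<^bsub>M\<^esub>"
    using mod_hom_zero[OF left_module_regular_module[OF R] LM h] by simp
  have "?f ` carrier r0.D = {x \<in> carrier r1.D. ?g x = \<zero>\<^bsub>M\<^esub>}"
  proof (intro equalityI subsetI)
    fix x assume "x \<in> ?f ` carrier r0.D"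
    then have "x = \<zero>\<^bsub>r1.D\<^esub>" by blast
    then show "x \<in> {x \<in> carrier r1.D. ?g x = \<zero>\<^bsub>M\<^esub>}"
      using h0 by simp
  next
    fix x assume "x \<in> {x \<in> carrier r1.D. ?g x = \<zero>\<^bsub>M\<^esub>}"
    then have x: "x \<in> carrier r1.D" "h (x 0) = h \<zero>\<^bsub>R\<^esub>"
      using h0 by simp_all
    have xP: "x \<in> (\<Pi>\<^sub>E i\<in>{..<Suc 0}. carrier R)"
      using x(1) by (simp add: r1.carrier)
    have "x 0 = \<zero>\<^bsub>R\<^esub>"
      using bij xP x(2) by (intro inj_onD[of h "carrier R"]) (auto simp: bij_betw_def)
    then have "x = \<zero>\<^bsub>r1.D\<^esub>"
      using xP by (intro extensionalityI[of _ "{..<Suc 0}"]) (simp_all add: PiE_iff zero_direct_sum)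
    then show "x \<in> ?f ` carrier r0.D"
      using r0.D.M.zero_closed by blast
  qed
  moreover have "?g ` carrier r1.D = carrier M"
  proof (intro equalityI subsetI)
    show "y \<in> carrier M" if "y \<in> ?g ` carrier r1.D" for y
      using that mod_hom_closed[OF g] by blast
    show "y \<in> ?g ` carrier r1.D" if "y \<in> carrier M" for y
    proof -
      have "y \<in> h ` carrier R"
        using that bij_betw_imp_surj_on[OF bij] by simp
      then obtain r where r: "y = h r" "r \<in> carrier R"
        by (rule imageE)
      have "ds_inj {..<Suc 0} (\<lambda>_. regular_module R) 0 r \<in> carrier r1.D"
        using mod_hom_closed[OF r1.ds_inj_hom[of 0], of r] r by simp
      moreover have "?g (ds_inj {..<Suc 0} (\<lambda>_. regular_module R) 0 r) = y"
        using r(1) by (simp add: ds_inj_apply)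
      ultimately show ?thesis by (metis imageI)
    qed
  qed
  ultimately have "\<exists>f g. f \<in> mod_hom R r0.D r1.D \<and> g \<in> mod_hom R r1.D M \<and>
      f ` carrier r0.D = {x \<in> carrier r1.D. g x = \<zero>\<^bsub>M\<^esub>} \<and> g ` carrier r1.D = carrier M"
    using f g by blast
  then show ?thesis
    unfolding finitely_presented_def Let_def a_kernel_def kernel_def monoid.simps partial_object.simps
    using LM by blast
qed

text \<open>The bound on \<open>carrier R\<close> provides an injection along which the regular
  module is copied into the universe \<open>'u\<close>.\<close>

lemma regular_class_nonempty:
  fixes R :: "('a, 'r) ring_scheme"
  assumes "ring R" "carrier R \<lesssim> (UNIV :: 'u set)"
  obtains Q :: "('a, 'u) module" where "Q \<in> regular_class R"
proof -
  obtain e :: "'a \<Rightarrow> 'u" where "inj_on e (carrier (regular_module R))"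
    using assms(2) by (auto simp: lepoll_def)
  then obtain Q :: "('a, 'u) module" where "left_module R Q" "e \<in> mod_hom R (regular_module R) Q"
    "bij_betw e (carrier (regular_module R)) (carrier Q)"
    by (rule module_transport[OF left_module_regular_module[OF assms(1)]])
  then have "mod_isomorphic R (regular_module R) Q"
    using left_module_regular_module[OF assms(1)] unfolding mod_isomorphic_def by blast
  then show ?thesis
    using that mod_isomorphic_sym unfolding regular_class_def by blast
qed

text \<open>Two homomorphisms to \<open>M\<close> with the same relations and the same composite
  from \<open>R^n\<close> factor through each other, so one representative for each such code
  suffices. The relation submodules are images of homomorphisms between free modules of finite rank,
  which bounds the number of codes by \<open>U\<close>.\<close>

lemma finitely_presented_hom_representatives:
  fixes R :: "('a, 'r) ring_scheme" and Xs :: "('a, 'u, 'm) module_scheme set"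
    and M :: "('a, 'v, 'n) module_scheme" and U :: "'w set"
  assumes R: "ring R" and U: "infinite U" "carrier R \<lesssim> U" "carrier M \<lesssim> U"
    and Xs: "\<And>Q. Q \<in> Xs \<Longrightarrow> finitely_presented R Q" and M: "left_module R M"
  obtains I :: "(nat \<times> (nat \<Rightarrow> 'a) set \<times> ((nat \<Rightarrow> 'a) \<Rightarrow> 'v)) set" and F h
  where "I \<lesssim> U" "\<And>i. i \<in> I \<Longrightarrow> F i \<in> Xs" "\<And>i. i \<in> I \<Longrightarrow> h i \<in> mod_hom R (F i) M"
    "\<And>Q k. Q \<in> Xs \<Longrightarrow> k \<in> mod_hom R Q M \<Longrightarrow>
      \<exists>i\<in>I. \<exists>t\<in>mod_hom R Q (F i). \<forall>x\<in>carrier Q. h i (t x) = k x"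
proof -
  \<comment> \<open>\<open>m\<close> and \<open>f\<close> enter the code only through the relation
    submodule. The composite is restricted so that maps agreeing on the free module have equal
    codes.\<close>
  define codes where "codes Q k c \<longleftrightarrow> (\<exists>m n f g.
      f \<in> mod_hom R (free_module R m) (free_module R n) \<and> g \<in> mod_hom R (free_module R n) Q \<and>
      g ` carrier (free_module R n) = carrier Q \<and>
      f ` carrier (free_module R m) = {x \<in> carrier (free_module R n). g x = \<zero>\<^bsub>Q\<^esub>} \<and>
      c = (n, f ` carrier (free_module R m), restrict (k \<circ> g) (carrier (free_module R n))))"
    for Q :: "('a, 'u, 'm) module_scheme" and k :: "'u \<Rightarrow> 'v" and c
  define I where "I = {c. \<exists>Q k. Q \<in> Xs \<and> k \<in> mod_hom R Q M \<and> codes Q k c}"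
  define rep where "rep c = (SOME (Q, k). Q \<in> Xs \<and> k \<in> mod_hom R Q M \<and> codes Q k c)" for c
  have rep: "fst (rep c) \<in> Xs \<and> snd (rep c) \<in> mod_hom R (fst (rep c)) M \<and>
      codes (fst (rep c)) (snd (rep c)) c" if "c \<in> I" for c
  proof -
    have "\<exists>Qk. case Qk of (Q, k) \<Rightarrow> Q \<in> Xs \<and> k \<in> mod_hom R Q M \<and> codes Q k c"
      using that by (auto simp: I_def)
    from someI_ex[OF this] show ?thesis
      by (simp add: rep_def case_prod_unfold)
  qed
  have free: "left_module R (free_module R n)" for n
    by (rule left_module_direct_sum[OF R left_module_regular_module[OF R]])
  have nat: "A \<lesssim> U" for A :: "nat set"
    using U(1) by (meson infinite_le_lepoll lepoll_trans subset_UNIV subset_imp_lepoll)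
  have free_U: "carrier (free_module R n) \<lesssim> U" for n
    by (rule direct_sum_lepoll[OF U(1) nat left_module_regular_module[OF R]]) (simp add: U(2))
  let ?Hom = "\<lambda>n. \<lambda>N. mod_hom R (free_module R n) N \<inter> extensional (carrier (free_module R n))"
  \<comment> \<open>The data that determine a code: \<open>n\<close>, \<open>m\<close>, a
    homomorphism whose image is the relation submodule, and the composite to \<open>M\<close>. Each
    of these ranges over a set no larger than \<open>U\<close>.\<close>
  let ?S = "SIGMA n:(UNIV::nat set). SIGMA m:(UNIV::nat set). ?Hom m (free_module R n) \<times> ?Hom n M"
  have "c \<in> (\<lambda>(n, m, f, t). (n, f ` carrier (free_module R m), t)) ` ?S" if "c \<in> I" for c
  proof -
    obtain Q k where k: "k \<in> mod_hom R Q M" and codes: "codes Q k c"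
      using \<open>c \<in> I\<close> unfolding I_def by blast
    obtain m n f g where *: "f \<in> mod_hom R (free_module R m) (free_module R n)"
      "g \<in> mod_hom R (free_module R n) Q"
      "c = (n, f ` carrier (free_module R m), restrict (k \<circ> g) (carrier (free_module R n)))"
      using codes unfolding codes_def by blast
    have "restrict f (carrier (free_module R m)) \<in> ?Hom m (free_module R n)"
      using *(1) by (simp add: restrict_mod_hom[OF free])
    moreover have "restrict (k \<circ> g) (carrier (free_module R n)) \<in> ?Hom n M"
      using mod_hom_compose[OF *(2) k] by (simp only: restrict_mod_hom[OF free] Int_iff restrict_extensional simp_thms)
    ultimately have "(n, m, restrict f (carrier (free_module R m)),
        restrict (k \<circ> g) (carrier (free_module R n))) \<in> ?S"
      by blast
    then show ?thesis
      by (rule rev_image_eqI) (simp add: *(3))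
  qed
  then have "I \<lesssim> ?S"
    by (meson subset_image_lepoll subsetI)
  also have "?S \<lesssim> U"
    by (intro Sigma_lepoll_infinite nat U free_module_hom_lepoll R free free_U M)
  finally have "I \<lesssim> U" .
  moreover have "\<exists>i\<in>I. \<exists>t\<in>mod_hom R Q (fst (rep i)). \<forall>x\<in>carrier Q. snd (rep i) (t x) = k x"
    if Q: "Q \<in> Xs" and k: "k \<in> mod_hom R Q M" for Q k
  proof -
    obtain m n f g where fg: "f \<in> mod_hom R (free_module R m) (free_module R n)"
      "g \<in> mod_hom R (free_module R n) Q" "g ` carrier (free_module R n) = carrier Q"
      "f ` carrier (free_module R m) = {x \<in> carrier (free_module R n). g x = \<zero>\<^bsub>Q\<^esub>}"
      using Xs[OF Q] by (rule finitely_presentedE)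
    define c where "c = (n, f ` carrier (free_module R m), restrict (k \<circ> g) (carrier (free_module R n)))"
    have "codes Q k c" unfolding codes_def c_def using fg by blast
    then have cI: "c \<in> I" using Q k unfolding I_def by blast
    obtain m' n' f' g' where fg': "f' \<in> mod_hom R (free_module R m') (free_module R n')"
      "g' \<in> mod_hom R (free_module R n') (fst (rep c))"
      "f' ` carrier (free_module R m') = {x \<in> carrier (free_module R n'). g' x = \<zero>\<^bsub>fst (rep c)\<^esub>}"
      and c': "c = (n', f' ` carrier (free_module R m'), restrict (snd (rep c) \<circ> g') (carrier (free_module R n')))"
      using rep[OF cI] unfolding codes_def by blast
    have n': "n' = n" and ker: "f ` carrier (free_module R m) = f' ` carrier (free_module R m')"
      and res: "restrict (k \<circ> g) (carrier (free_module R n)) = restrict (snd (rep c) \<circ> g') (carrier (free_module R n))"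
      using c' by (auto simp: c_def)
    \<comment> \<open>Equal codes mean that \<open>g\<close> and \<open>g'\<close> have the same
      kernel, so \<open>g'\<close> factors through the surjection \<open>g\<close>. Equality of the
      composites to \<open>M\<close> then says that \<open>t\<close> is compatible with
      \<open>k\<close> and \<open>snd (rep c)\<close>.\<close>
    obtain t where t: "t \<in> mod_hom R Q (fst (rep c))"
      "\<And>x. x \<in> carrier (free_module R n) \<Longrightarrow> t (g x) = g' x"
    proof (rule mod_hom_factor[OF free _ _ fg(2,3)])
      show "left_module R Q" "left_module R (fst (rep c))"
        using Q Xs rep[OF cI] finitely_presented_left_module by blast+
      show "g' \<in> mod_hom R (free_module R n) (fst (rep c))"
        using fg'(2) by (simp add: n')
      show "g' x = \<zero>\<^bsub>fst (rep c)\<^esub>" if "x \<in> carrier (free_module R n)" "g x = \<zero>\<^bsub>Q\<^esub>" for x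
        using that fg(4) fg'(3) ker by blast
    qed blast
    have "snd (rep c) (t x) = k x" if x: "x \<in> carrier Q" for x
    proof -
      obtain y where "y \<in> carrier (free_module R n)" "x = g y"
        using x fg(3) by blast
      then show ?thesis using fun_cong[OF res, of y] t(2) by simp
    qed
    then show ?thesis using cI t(1) by blast
  qed
  ultimately show ?thesis
    using that[of I "\<lambda>i. fst (rep i)" "\<lambda>i. snd (rep i)"] rep by blast
qed

section \<open>Local endomorphism rings\<close>

text \<open>If no \<open>F i\<close> has \<open>M\<close> as a summand, each map \<open>u i\<close>
  from \<open>M\<close> through \<open>F i\<close> back to \<open>M\<close> is a non-unit. In a
  local ring their sum is then a non-unit too, although it is the identity.\<close>

lemma local_ring_direct_summand:
  fixes F :: "nat \<Rightarrow> ('a, 'u, 'm) module_scheme"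
  assumes loc: "local_ring (End_ring R M)" and R: "ring R"
    and F: "\<And>i. i < n \<Longrightarrow> left_module R (F i)" and M: "direct_summand R M (direct_sum {..<n} F)"
  shows "\<exists>i<n. direct_summand R M (F i)"
proof (rule ccontr)
  assume no: "\<not> (\<exists>i<n. direct_summand R M (F i))"
  interpret module_family R "{..<n}" F by (rule module_family.intro[OF R]) (simp add: F)
  let ?E = "End_ring R M"
  interpret E: ring ?E using loc by (simp add: local_ring_def)
  have E_carrier: "h \<in> carrier ?E \<longleftrightarrow> h \<in> mod_hom R M M \<and> h \<in> extensional (carrier M)" for h
    by (simp add: End_ring_def carrier_Hom_group)
  have E_mult: "h \<otimes>\<^bsub>?E\<^esub> k = compose (carrier M) h k" for h k
    by (simp add: End_ring_def)
  have E_add: "h \<oplus>\<^bsub>?E\<^esub> k = (\<lambda>x\<in>carrier M. h x \<oplus>\<^bsub>M\<^esub> k x)" for h k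
    by (simp add: End_ring_def Hom_group_def)
  have E_one: "\<one>\<^bsub>?E\<^esub> = (\<lambda>x\<in>carrier M. x)" and E_zero: "\<zero>\<^bsub>?E\<^esub> = (\<lambda>x\<in>carrier M. \<zero>\<^bsub>M\<^esub>)"
    by (simp_all add: End_ring_def Hom_group_def)
  obtain s p where LM: "left_module R M" and s: "s \<in> mod_hom R M D" and p: "p \<in> mod_hom R D M"
    and ps: "\<And>x. x \<in> carrier M \<Longrightarrow> p (s x) = x"
    using M by (rule direct_summandE) blast
  have sD: "s x \<in> carrier D" if "x \<in> carrier M" for x
    by (rule mod_hom_closed[OF s that])
  have mem: "x i \<in> carrier (F i)" if "x \<in> carrier D" "i < n" for x i
    using that by (simp add: carrier PiE_iff)
  have s_i: "(\<lambda>x. x i) \<circ> s \<in> mod_hom R M (F i)" if "i < n" for i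
    by (rule mod_hom_compose[OF s ds_proj_hom]) (simp add: that)
  have p_i: "p \<circ> ds_inj {..<n} F i \<in> mod_hom R (F i) M" if "i < n" for i
    by (rule mod_hom_compose[OF ds_inj_hom p]) (simp add: that)
  define u where "u i = (\<lambda>x\<in>carrier M. p (ds_inj {..<n} F i (s x i)))" for i
  have u: "u i \<in> carrier ?E - Units ?E" if i: "i < n" for i
  proof
    have "p \<circ> ds_inj {..<n} F i \<circ> ((\<lambda>x. x i) \<circ> s) \<in> mod_hom R M M"
      by (rule mod_hom_compose[OF s_i[OF i] p_i[OF i]])
    then have "u i \<in> mod_hom R M M"
      using mod_hom_cong[OF LM, of "u i" "p \<circ> ds_inj {..<n} F i \<circ> ((\<lambda>x. x i) \<circ> s)" M] by (simp add: u_def)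
    then show "u i \<in> carrier ?E"
      by (simp add: E_carrier u_def)
    show "u i \<notin> Units ?E"
    proof
      \<comment> \<open>A left inverse \<open>w\<close> of \<open>u i\<close> yields a retraction of
        the \<open>i\<close>-th coordinate of \<open>s\<close>, namely the injection of
        \<open>F i\<close> followed by \<open>p\<close> and \<open>w\<close>. Then \<open>M\<close>
        is a summand of \<open>F i\<close>.\<close>
      assume "u i \<in> Units ?E"
      then obtain w where w: "w \<in> carrier ?E" "w \<otimes>\<^bsub>?E\<^esub> u i = \<one>\<^bsub>?E\<^esub>"
        by (auto simp: Units_def)
      have wM: "w \<in> mod_hom R M M" using w(1) by (simp add: E_carrier)
      have "(w \<circ> (p \<circ> ds_inj {..<n} F i)) (((\<lambda>x. x i) \<circ> s) x) = x" if "x \<in> carrier M" for x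
        using fun_cong[OF w(2), of x] that by (simp add: E_mult E_one compose_def u_def)
      then have "direct_summand R M (F i)"
        by (rule direct_summandI[OF LM F[OF i] s_i[OF i] mod_hom_compose[OF p_i[OF i] wM]])
      then show False using no i by blast
    qed
  qed
  \<comment> \<open>\<open>cut k\<close> keeps the coordinates below \<open>k\<close>, so
    \<open>v k\<close> is the sum of the \<open>u i\<close> with \<open>i < k\<close>: it is zero
    for \<open>k = 0\<close> and the identity for \<open>k = n\<close>.\<close>
  define cut where "cut k x = (\<lambda>i\<in>{..<n}. if i < k then x i else \<zero>\<^bsub>F i\<^esub>)" for k x
  define v where "v k = (\<lambda>x\<in>carrier M. p (cut k (s x)))" for k
  have cut: "cut k x \<in> carrier D" if "x \<in> carrier D" for k x
  proof -
    have "cut k x \<in> (\<Pi>\<^sub>E i\<in>{..<n}. carrier (F i))"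
      using mem[OF that] module_zero_closed by (simp add: cut_def)
    then show ?thesis unfolding carrier by (intro CollectI conjI) simp_all
  qed
  have "v k \<in> carrier ?E - Units ?E" if "k \<le> n" for k
    using that
  proof (induction k)
    case 0
    have "cut 0 x = \<zero>\<^bsub>D\<^esub>" for x
      by (simp add: cut_def zero_direct_sum)
    then have "v 0 = \<zero>\<^bsub>?E\<^esub>"
      unfolding v_def E_zero using mod_hom_zero[OF D.left_module_axioms LM p] by simp
    \<comment> \<open>Zero is not a unit because one differs from zero in a local ring. This also
      settles the empty sum \<open>n = 0\<close>.\<close>
    moreover have "\<zero>\<^bsub>?E\<^esub> \<notin> Units ?E"
      using loc E.zero_closed by (auto simp: local_ring_def Units_def)
    ultimately show ?case by simp
  next
    case (Suc k)
    then have k: "k < n" by simp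
    have cut_Suc: "cut (Suc k) x = cut k x \<oplus>\<^bsub>D\<^esub> ds_inj {..<n} F k (x k)" if "x \<in> carrier D" for x
    proof (rule extensionalityI[of _ "{..<n}"])
      fix i assume i: "i \<in> {..<n}"
      interpret Fi: left_module R "F i" using F i by simp
      have "x i \<oplus>\<^bsub>F i\<^esub> \<zero>\<^bsub>F i\<^esub> = x i" "\<zero>\<^bsub>F i\<^esub> \<oplus>\<^bsub>F i\<^esub> x i = x i" "\<zero>\<^bsub>F i\<^esub> \<oplus>\<^bsub>F i\<^esub> \<zero>\<^bsub>F i\<^esub> = \<zero>\<^bsub>F i\<^esub>"
        using mem[OF that] i by simp_all
      then show "cut (Suc k) x i = (cut k x \<oplus>\<^bsub>D\<^esub> ds_inj {..<n} F k (x k)) i"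
        using i by (auto simp: cut_def ds_inj_apply less_Suc_eq)
    qed (simp_all add: cut_def add_direct_sum)
    have inj: "ds_inj {..<n} F k (x k) \<in> carrier D" if "x \<in> carrier D" for x
      using mod_hom_closed[OF ds_inj_hom[of k] mem[OF that k]] k by simp
    have "v (Suc k) = v k \<oplus>\<^bsub>?E\<^esub> u k"
      unfolding E_add v_def u_def
    proof (rule restrict_ext)
      fix x assume x: "x \<in> carrier M"
      show "p (cut (Suc k) (s x)) = (\<lambda>x\<in>carrier M. p (cut k (s x))) x \<oplus>\<^bsub>M\<^esub>
          (\<lambda>x\<in>carrier M. p (ds_inj {..<n} F k (s x k))) x"
        using x mod_hom_add[OF p cut[OF sD[OF x]] inj[OF sD[OF x]]] by (simp add: cut_Suc[OF sD[OF x]])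
    qed
    then show ?case
      using loc Suc u[OF k] unfolding local_ring_def by simp
  qed
  then have "v n \<notin> Units ?E" by blast
  moreover have "v n = \<one>\<^bsub>?E\<^esub>"
    unfolding v_def E_one
  proof (rule restrict_ext)
    fix x assume x: "x \<in> carrier M"
    have "cut n (s x) = s x"
      using sD[OF x] by (intro extensionalityI[of _ "{..<n}"]) (simp_all add: cut_def carrier PiE_iff)
    then show "p (cut n (s x)) = x" using ps[OF x] by simp
  qed
  ultimately show False by simp
qed

section \<open>From purity to summands of finite direct sums\<close>

text \<open>The sum \<open>D\<close> of representatives maps onto \<open>M\<close> in such a way
  that homomorphisms from modules in \<open>?Xs\<close> lift, so the kernel sequence is pure for
  \<open>S\<close>. Purity for \<open>T\<close> makes \<open>M\<close> a summand of
  \<open>D\<close>, and finite generation of \<open>N\<close>, hence of \<open>M\<close>, cuts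
  \<open>D\<close> down to finitely many components.\<close>

lemma pure_imp_pure_summand_in_add:
  fixes R :: "('a, 'r) ring_scheme" and S T :: "('a, 'u) module set" and M :: "('a, 'u) module"
  assumes R: "ring R" and U: "infinite (UNIV :: 'u set)" "carrier R \<lesssim> (UNIV :: 'u set)"
    and S: "\<And>M. M \<in> S \<Longrightarrow> finitely_presented R M"
    and T: "\<And>M. M \<in> T \<Longrightarrow> finitely_presented R M"
    and pure: "pure_imp_pure R S T" and N: "N \<in> T" and MN: "direct_summand R M N"
  shows "M \<in> add_class R (S \<union> regular_class R)"
proof -
  let ?Xs = "S \<union> regular_class R :: ('a, 'u) module set"
  obtain s p where M: "left_module R M" and s: "s \<in> mod_hom R M N" and p: "p \<in> mod_hom R N M"
    and ps: "\<And>x. x \<in> carrier M \<Longrightarrow> p (s x) = x"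
    using MN by (rule direct_summandE) blast
  interpret M: left_module R M by fact
  have Xs: "finitely_presented R Q" if "Q \<in> ?Xs" for Q
    using that S regular_class_finitely_presented[OF R] by blast
  have "carrier M \<lesssim> (UNIV :: 'u set)" by (simp add: subset_imp_lepoll)
  then obtain I :: "(nat \<times> (nat \<Rightarrow> 'a) set \<times> ((nat \<Rightarrow> 'a) \<Rightarrow> 'u)) set"
    and F :: "_ \<Rightarrow> ('a, 'u) module" and h
    where I: "I \<lesssim> (UNIV :: 'u set)" and F: "\<And>i. i \<in> I \<Longrightarrow> F i \<in> ?Xs"
      and h: "\<And>i. i \<in> I \<Longrightarrow> h i \<in> mod_hom R (F i) M"
      and fac: "\<And>Q k. Q \<in> ?Xs \<Longrightarrow> k \<in> mod_hom R Q M \<Longrightarrow>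
        \<exists>i\<in>I. \<exists>t\<in>mod_hom R Q (F i). \<forall>x\<in>carrier Q. h i (t x) = k x"
    using finitely_presented_hom_representatives[OF R U _ Xs M] by metis
  have LF: "left_module R (F i)" if "i \<in> I" for i
    using Xs[OF F[OF that]] by (rule finitely_presented_left_module)
  interpret module_family R I F by (rule module_family.intro[OF R LF])
  let ?q = "ds_lift M h"
  have q: "?q \<in> mod_hom R D M" by (rule ds_lift_hom[OF M h])
  have "carrier D \<lesssim> (UNIV :: 'u set)"
    by (rule direct_sum_lepoll[OF U(1) I LF]) (simp_all add: subset_imp_lepoll)
  then obtain e :: "_ \<Rightarrow> 'u" where "inj_on e (carrier D)"
    by (auto simp: lepoll_def)
  \<comment> \<open>\<open>pure_imp_pure\<close> speaks of sequences with elements in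
    \<open>'u\<close>, so \<open>D\<close> is replaced by a copy there. The copy exists because the
    index set and all components are no larger than \<open>'u\<close>.\<close>
  with D.left_module_axioms obtain P :: "('a, 'u) module" where P: "left_module R P"
    and e: "e \<in> mod_hom R D P" "bij_betw e (carrier D) (carrier P)"
    by (rule module_transport)
  let ?d = "inv_into (carrier D) e"
  have d: "?d \<in> mod_hom R P D"
    by (rule mod_hom_inv_into[OF D.left_module_axioms e])
  have de: "?d (e x) = x" if "x \<in> carrier D" for x
    using e(2) that by (simp add: bij_betw_def)
  let ?qP = "?q \<circ> ?d"
  have qP: "?qP \<in> mod_hom R P M" by (rule mod_hom_compose[OF d q])
  \<comment> \<open>\<open>k\<close> factors through some representative \<open>F i\<close>, and the
    inclusion of this summand turns the factorization into a lift.\<close>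
  have lifts: "lifts R Q P M ?qP" if Q: "Q \<in> ?Xs" for Q
    unfolding lifts_def
  proof
    fix k assume "k \<in> mod_hom R Q M"
    then obtain i t where i: "i \<in> I" and t: "t \<in> mod_hom R Q (F i)"
      "\<And>x. x \<in> carrier Q \<Longrightarrow> h i (t x) = k x"
      using fac[OF Q] by blast
    have "ds_inj I F i \<circ> t \<in> mod_hom R Q D"
      by (rule mod_hom_compose[OF t(1) ds_inj_hom[OF i]])
    then have "e \<circ> (ds_inj I F i \<circ> t) \<in> mod_hom R Q P"
      by (rule mod_hom_compose[OF _ e(1)])
    moreover have "?qP ((e \<circ> (ds_inj I F i \<circ> t)) x) = k x" if "x \<in> carrier Q" for x
      using mod_hom_closed[OF t(1) that] mod_hom_closed[OF ds_inj_hom[OF i]] t(2)[OF that]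
      by (simp add: de ds_lift_inj[OF M h i])
    ultimately show "\<exists>k'\<in>mod_hom R Q P. \<forall>x\<in>carrier Q. ?qP (k' x) = k x"
      by blast
  qed
  \<comment> \<open>Copies of the regular module give surjectivity: \<open>y\<close> is the value at
    one of the homomorphism \<open>r |-> r y\<close>, and this homomorphism lifts.\<close>
  have sur: "?qP ` carrier P = carrier M"
  proof (intro equalityI subsetI)
    show "y \<in> carrier M" if "y \<in> ?qP ` carrier P" for y
      using that mod_hom_closed[OF qP] by blast
    fix y assume y: "y \<in> carrier M"
    obtain Q :: "('a, 'u) module" where Q: "Q \<in> regular_class R"
      using regular_class_nonempty[OF R U(2)] .
    then obtain c where c: "c \<in> mod_hom R Q (regular_module R)"
      "c ` carrier Q = carrier R"
      by (auto simp: regular_class_def mod_isomorphic_def bij_betw_def)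
    have "(\<lambda>r. r \<odot>\<^bsub>M\<^esub> y) \<in> mod_hom R (regular_module R) M"
      using y by (intro mod_homI) (simp_all add: M.smult_l_distr M.smult_assoc1)
    with c(1) have "(\<lambda>r. r \<odot>\<^bsub>M\<^esub> y) \<circ> c \<in> mod_hom R Q M"
      by (rule mod_hom_compose)
    with lifts[OF UnI2[OF Q]]
    obtain k where k: "k \<in> mod_hom R Q P"
      "\<And>x. x \<in> carrier Q \<Longrightarrow> ?qP (k x) = ((\<lambda>r. r \<odot>\<^bsub>M\<^esub> y) \<circ> c) x"
      by (rule liftsE) blast
    have "\<one>\<^bsub>R\<^esub> \<in> c ` carrier Q"
      by (simp add: c(2))
    then obtain x where x: "\<one>\<^bsub>R\<^esub> = c x" "x \<in> carrier Q"
      by (rule imageE)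
    have "?qP (k x) = y"
      using k(2)[OF x(2)] y by (simp flip: x(1))
    then show "y \<in> ?qP ` carrier P"
      using mod_hom_closed[OF k(1) x(2)] by (metis imageI)
  qed
  let ?K = "P\<lparr>carrier := {x \<in> carrier P. ?qP x = \<zero>\<^bsub>M\<^esub>}\<rparr>"
  have se: "mod_short_exact R ?K P M (\<lambda>x. x) ?qP"
    by (rule mod_short_exact_kernel[OF P M qP sur])
  have "pure R S ?K P M (\<lambda>x. x) ?qP"
    using pure_iff_lifts[OF se, of S] lifts S finitely_presented_left_module by blast
  then have "pure R T ?K P M (\<lambda>x. x) ?qP"
    using pure se unfolding pure_imp_pure_def by blast
  then have "lifts R N P M ?qP"
    using pure_iff_lifts[OF se, of T] N T finitely_presented_left_module by blast
  then obtain l where l: "l \<in> mod_hom R N P" "\<And>x. x \<in> carrier N \<Longrightarrow> ?qP (l x) = p x"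
    using p by (rule liftsE) blast
  \<comment> \<open>The lift \<open>l\<close> of the retraction \<open>p\<close>, restricted along
    \<open>s\<close> and moved back to \<open>D\<close>, is a section of \<open>?q\<close>.\<close>
  let ?s = "?d \<circ> (l \<circ> s)"
  have s': "?s \<in> mod_hom R M D"
    by (rule mod_hom_compose[OF mod_hom_compose[OF s l(1)] d])
  have qs: "?q (?s x) = x" if "x \<in> carrier M" for x
    using l(2)[OF mod_hom_closed[OF s that]] ps[OF that] by simp
  obtain n g where g: "g \<in> mod_hom R (free_module R n) N" "g ` carrier (free_module R n) = carrier N"
    using T[OF N] by (rule finitely_presentedE)
  have gM: "p \<circ> g \<in> mod_hom R (free_module R n) M"
    by (rule mod_hom_compose[OF g(1) p])
  \<comment> \<open>\<open>M\<close> is the image of a free module of finite rank under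
    \<open>p\<close> after \<open>g\<close>, so one finite set contains the supports of all values
    of \<open>?s\<close>.\<close>
  obtain J where J: "finite J" "J \<subseteq> I"
    "\<And>x i. x \<in> carrier (free_module R n) \<Longrightarrow> i \<in> I - J \<Longrightarrow> (?s \<circ> (p \<circ> g)) x i = \<zero>\<^bsub>F i\<^esub>"
    using free_module_hom_finite_support[OF R LF mod_hom_compose[OF gM s']] by metis
  have "?s x i = \<zero>\<^bsub>F i\<^esub>" if x: "x \<in> carrier M" and i: "i \<in> I - J" for x i
  proof -
    obtain y where "y \<in> carrier (free_module R n)" "s x = g y"
      using mod_hom_closed[OF s x] g(2) by blast
    then show ?thesis using J(3)[of y i] i ps[OF x] by simp
  qed
  then obtain n e' where *: "e' ` {..<n::nat} \<subseteq> I" "direct_summand R M (direct_sum {..<n} (\<lambda>j. F (e' j)))"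
    using direct_summand_finite_subsum[OF R LF M s' q qs J(1,2)] by metis
  have "F (e' j) \<in> ?Xs" if "j < n" for j
    using *(1) that by (intro F) blast
  with *(2) have "(\<forall>j<n. F (e' j) \<in> ?Xs) \<and> direct_summand R M (direct_sum {..<n} (\<lambda>j. F (e' j)))"
    by simp
  then show ?thesis
    unfolding add_class_def mem_Collect_eq by (intro exI)
qed

section \<open>The three implications between purity and the summand conditions\<close>

theorem proposition2p4:
  fixes R :: "('a, 'r) ring_scheme"
    and S T :: "('a, 'u) module set"
  assumes "ring R"
    and "infinite (UNIV :: 'u set)" and "carrier R \<lesssim> (UNIV :: 'u set)"
    and "iso_closed R S" and "\<forall>M \<in> S. finitely_presented R M"
    and "iso_closed R T" and "\<forall>M \<in> T. finitely_presented R M"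
  shows "(pure_imp_pure R S T \<longrightarrow> summands_in_add R S T) \<and>
    ((\<forall>M \<in> indecomposable_summands R T. local_ring (End_ring R M)) \<longrightarrow>
      summands_in_add R S T \<longrightarrow> summands_are_summands R S T) \<and>
    ((\<forall>M \<in> T. direct_sum_of_indecomposables R M) \<longrightarrow>
      summands_are_summands R S T \<longrightarrow> pure_imp_pure R S T)"
proof (intro conjI impI)
  note fp = bspec[OF assms(5)] bspec[OF assms(7)]
  assume "pure_imp_pure R S T"
  then show "summands_in_add R S T"
    using pure_imp_pure_summand_in_add[OF assms(1-3) fp] unfolding summands_in_add_def indecomposable_summands_def
    by blast
next
  assume loc: "\<forall>M \<in> indecomposable_summands R T. local_ring (End_ring R M)"
    and add: "summands_in_add R S T"
  show "summands_are_summands R S T"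
    unfolding summands_are_summands_def
  proof
    fix M assume M: "M \<in> indecomposable_summands R T"
    then obtain n :: nat and F where F: "\<And>i. i < n \<Longrightarrow> F i \<in> S \<union> regular_class R"
      and sum: "direct_summand R M (direct_sum {..<n} F)"
      using add unfolding summands_in_add_def add_class_def by blast
    have "left_module R (F i)" if "i < n" for i
      using F[OF that] assms(5) finitely_presented_left_module
      by (auto simp: regular_class_def mod_isomorphic_def)
    then obtain i where "i < n" "direct_summand R M (F i)"
      using local_ring_direct_summand[OF bspec[OF loc M] assms(1) _ sum] by blast
    then show "\<exists>N\<in>S \<union> regular_class R. direct_summand R M N"
      using F by blast
  qed
next
  assume dec: "\<forall>M \<in> T. direct_sum_of_indecomposables R M" and sum: "summands_are_summands R S T"
  show "pure_imp_pure R S T"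
    unfolding pure_imp_pure_def
  proof (intro allI impI, elim conjE)
    fix A B C :: "('a, 'u) module" and f g
    assume se: "mod_short_exact R A B C f g" and pS: "pure R S A B C f g"
    have B: "left_module R B" and C: "left_module R C" and g: "g \<in> mod_hom R B C"
      and sur: "g ` carrier B = carrier C"
      using se by (auto simp: mod_short_exact_def short_exact_def epi_def)
    have lm: "left_module R M" if "M \<in> S \<or> M \<in> T" for M
      using that assms(5,7) finitely_presented_left_module by blast
    \<comment> \<open>For modules in \<open>S\<close> this is the assumed purity, for copies of the
      regular module it is projectivity.\<close>
    have lS: "lifts R N B C g" if "N \<in> S \<union> regular_class R" for N
      using that
    proof
      assume "N \<in> S"
      then show ?thesis using pure_iff_lifts[OF se, of S] pS lm by blast
    next
      assume "N \<in> regular_class R"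
      then have "direct_summand R N (regular_module R)"
        by (simp add: regular_class_def direct_summand_mod_isomorphic)
      then show ?thesis
        by (rule lifts_direct_summand[OF _ lifts_regular_module[OF assms(1) B g sur]])
    qed
    have "lifts R M B C g" if M: "M \<in> T" for M
    proof -
      obtain I :: "'u set" and F :: "'u \<Rightarrow> ('a, 'u) module"
        where ind: "\<And>i. i \<in> I \<Longrightarrow> indecomposable R (F i)" and iso: "mod_isomorphic R M (direct_sum I F)"
        using dec M unfolding direct_sum_of_indecomposables_def by blast
      have F: "left_module R (F i)" if "i \<in> I" for i
        using ind[OF that] by (simp add: indecomposable_def)
      \<comment> \<open>Each component of \<open>M\<close> is an indecomposable summand of a module
        in \<open>T\<close>, so by assumption it is a summand of some \<open>N\<close> in
        \<open>S\<close> or isomorphic to the regular module. The lifting property passes from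
        \<open>N\<close> to it.\<close>
      have Fl: "lifts R (F i) B C g" if i: "i \<in> I" for i
      proof -
        have "direct_summand R (F i) M"
          using direct_summand_direct_sum[OF assms(1) F i]
            direct_summand_mod_isomorphic[OF mod_isomorphic_sym[OF iso]]
          by (rule direct_summand_trans)
        then have "F i \<in> indecomposable_summands R T"
          using ind[OF i] M unfolding indecomposable_summands_def by blast
        then obtain N where "N \<in> S \<union> regular_class R" "direct_summand R (F i) N"
          using sum unfolding summands_are_summands_def by blast
        then show ?thesis
          using lifts_direct_summand[OF _ lS] by blast
      qed
      have "lifts R (direct_sum I F) B C g"
        by (rule lifts_direct_sum[OF assms(1) F B C g Fl])
      then show ?thesis
        by (rule lifts_direct_summand[OF direct_summand_mod_isomorphic[OF iso]])
    qed
    then show "pure R T A B C f g"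
      using pure_iff_lifts[OF se, of T] lm by blast
  qed
qed

end
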